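(* Let $J\subset R=K[x_1,\dots,x_n]$ be an almost revlex ideal, $B_J$ its minimal monomial basis, $\delta$ the Krull dimension of $R/J$ and $H$ the Hilbert function of $R/J$. Then $$\vert B_J \vert =\begin{cases} \displaystyle\sum_{s=0}^{n-1} \Delta^{s} H(c_{s+1}), & \text{if } \delta=0,\\[2mm] \displaystyle\sum_{s=\delta}^{n-1} \Delta^{s} H(c_{s+1}) + \Delta^{\delta-1}H(c_\delta)-\Delta^{\delta-1}H(\varrho), & \text{if } \delta>0,\end{cases}$$ where $\varrho=\min\{t : \Delta^{\delta-1}H(j)=\Delta^{\delta-1}H(j+1)\ \text{for all } j\geq t\}$.
   Context: $K$ is a field and $R=K[x_1,\dots,x_n]$ has its standard grading and is endowed with the degree reverse lexicographic term order $\succ$ with $x_1\succ\dots\succ x_n$. $\mathbb T_t$ is the set of terms of $R$ of degree $t$. Ideals are proper. The Hilbert function of $R/J$ is $H(t)=\dim_K(R/J)_t$. For a monomial ideal $J$, $B_J$ is its set of minimal monomial generators. A monomial ideal $J\subset R$ is almost revlex if, for every $\tau\in B_J$ and every $\tau'\in\mathbb T_{\deg(\tau)}$, $\tau'\succ\tau$ implies $\tau'\in J$. Derivatives: $\Delta^0H(t):=H(t)$ and, for $1\leq i\leq n$, $\Delta^iH(0):=1$ and $\Delta^iH(t):=\Delta^{i-1}H(t)-\Delta^{i-1}H(t-1)$ for $t>0$. For $\delta\leq s\leq n$, $c_s=c_s(H):=\max\{c \mid \Delta^sH(j)>0 \text{ for all } 0\leq j\leq c\}$. *)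

theory Defs
  imports
    "HOL-Algebra.QuotRing"
    "HOL-Algebra.Embedded_Algebras"
    "HOL-Library.Poly_Mapping"
    "HOL-Library.Extended_Nat"
begin

text \<open>
  A term is an exponent vector of type \<open>nat \<Rightarrow>\<^sub>0 nat\<close>; the variables of the polynomial ring
  in \<open>n\<close> variables are indexed by \<open>{1..n}\<close>.  A polynomial maps terms to coefficients, and its
  arithmetic is the convolution arithmetic of \<open>Poly_Mapping\<close>.
\<close>

type_synonym pterm = "nat \<Rightarrow>\<^sub>0 nat"

definition terms :: "nat \<Rightarrow> pterm set" where
  "terms n = {t. Poly_Mapping.keys t \<subseteq> {1..n}}"

definition tdeg :: "pterm \<Rightarrow> nat" where
  "tdeg t = (\<Sum>i\<in>Poly_Mapping.keys t. Poly_Mapping.lookup t i)"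

definition terms_of_deg :: "nat \<Rightarrow> nat \<Rightarrow> pterm set" where
  "terms_of_deg n d = {t \<in> terms n. tdeg t = d}"

definition mon :: "pterm \<Rightarrow> (pterm \<Rightarrow>\<^sub>0 'k::field)" where
  "mon t = Poly_Mapping.single t 1"

definition mpoly_ring :: "nat \<Rightarrow> (pterm \<Rightarrow>\<^sub>0 'k::field) ring" where
  "mpoly_ring n = \<lparr>carrier = {f. Poly_Mapping.keys f \<subseteq> terms n}, mult = (*), one = 1, zero = 0, add = (+)\<rparr>"

text \<open>
  \<open>degrevlex_gr s t\<close> means that \<open>s\<close> is strictly larger than \<open>t\<close>.  For equal degrees, \<open>s\<close> is the
  larger term iff at the last index where the exponents differ it has the smaller exponent; thus
  \<open>x\<^sub>1\<close> is the largest and \<open>x\<^sub>n\<close> the smallest variable.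
\<close>

definition degrevlex_gr :: "pterm \<Rightarrow> pterm \<Rightarrow> bool" where
  "degrevlex_gr s t \<longleftrightarrow>
     tdeg s > tdeg t \<or>
     (tdeg s = tdeg t \<and>
      (\<exists>i. Poly_Mapping.lookup s i < Poly_Mapping.lookup t i \<and> (\<forall>j>i. Poly_Mapping.lookup s j = Poly_Mapping.lookup t j)))"

definition monomial_ideal :: "nat \<Rightarrow> (pterm \<Rightarrow>\<^sub>0 'k::field) set \<Rightarrow> bool" where
  "monomial_ideal n J \<longleftrightarrow> (\<exists>S \<subseteq> terms n. J = genideal (mpoly_ring n) (mon ` S))"

definition is_min_monomial_basis ::
    "nat \<Rightarrow> (pterm \<Rightarrow>\<^sub>0 'k::field) set \<Rightarrow> pterm set \<Rightarrow> bool" where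
  "is_min_monomial_basis n J B \<longleftrightarrow>
     B \<subseteq> terms n \<and> genideal (mpoly_ring n) (mon ` B) = J \<and>
     (\<forall>B' \<subset> B. genideal (mpoly_ring n) (mon ` B') \<noteq> J)"

text \<open>Existence and uniqueness for monomial ideals is lemma \<open>ex1_min_monomial_basis\<close> below.\<close>

definition min_monomial_basis :: "nat \<Rightarrow> (pterm \<Rightarrow>\<^sub>0 'k::field) set \<Rightarrow> pterm set" where
  "min_monomial_basis n J = (THE B. is_min_monomial_basis n J B)"

definition almost_revlex :: "nat \<Rightarrow> (pterm \<Rightarrow>\<^sub>0 'k::field) set \<Rightarrow> bool" where
  "almost_revlex n J \<longleftrightarrow>
     monomial_ideal n J \<and>
     (\<forall>\<tau> \<in> min_monomial_basis n J. \<forall>\<tau>' \<in> terms_of_deg n (tdeg \<tau>).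
        degrevlex_gr \<tau>' \<tau> \<longrightarrow> mon \<tau>' \<in> J)"

definition homogeneous_part :: "nat \<Rightarrow> nat \<Rightarrow> (pterm \<Rightarrow>\<^sub>0 'k::field) set" where
  "homogeneous_part n d = {f. Poly_Mapping.keys f \<subseteq> terms_of_deg n d}"

text \<open>
  The Hilbert function of the quotient \<open>R/J\<close>: the quotient contains the field of (classes of)
  constants, and its component of degree \<open>t\<close> is the image of the component of \<open>R\<close> of degree \<open>t\<close>.
\<close>

definition hilbert_fun :: "nat \<Rightarrow> (pterm \<Rightarrow>\<^sub>0 'k::field) set \<Rightarrow> nat \<Rightarrow> nat" where
  "hilbert_fun n J t =
     ring.dim (mpoly_ring n Quot J)
       (range (\<lambda>a. J +>\<^bsub>mpoly_ring n\<^esub> Poly_Mapping.single 0 a))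
       ((\<lambda>f. J +>\<^bsub>mpoly_ring n\<^esub> f) ` homogeneous_part n t)"

definition krull_dim :: "('a, 'b) ring_scheme \<Rightarrow> enat" where
  "krull_dim A =
     Sup {enat k |k. \<exists>P :: nat \<Rightarrow> 'a set.
            (\<forall>i\<le>k. primeideal (P i) A) \<and> (\<forall>i<k. P i \<subset> P (Suc i))}"

text \<open>Derivatives may be negative, hence the integer-valued functions.\<close>

fun deriv_fun :: "nat \<Rightarrow> (nat \<Rightarrow> int) \<Rightarrow> nat \<Rightarrow> int" where
  "deriv_fun 0 H t = H t"
| "deriv_fun (Suc i) H 0 = 1"
| "deriv_fun (Suc i) H (Suc t) = deriv_fun i H (Suc t) - deriv_fun i H t"

definition c_max :: "(nat \<Rightarrow> int) \<Rightarrow> nat \<Rightarrow> nat" where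
  "c_max H s = Max {c. \<forall>j\<le>c. deriv_fun s H j > 0}"

definition rho_min :: "(nat \<Rightarrow> int) \<Rightarrow> nat \<Rightarrow> nat" where
  "rho_min H \<delta> = (LEAST t. \<forall>j\<ge>t. deriv_fun (\<delta> - 1) H j = deriv_fun (\<delta> - 1) H (j + 1))"


subsection \<open>Basic facts\<close>

lemma mpoly_ring_simps [simp]:
  "carrier (mpoly_ring n) = {f. Poly_Mapping.keys f \<subseteq> terms n}"
  "mult (mpoly_ring n) = (*)" "one (mpoly_ring n) = 1"
  "zero (mpoly_ring n) = 0" "add (mpoly_ring n) = (+)"
  by (simp_all add: mpoly_ring_def)

lemma keys_add_nat: "Poly_Mapping.keys (s + t :: pterm) = Poly_Mapping.keys s \<union> Poly_Mapping.keys t"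
  by (auto simp: in_keys_iff lookup_add)

lemma terms_add_iff: "s + t \<in> terms n \<longleftrightarrow> s \<in> terms n \<and> t \<in> terms n"
  by (auto simp: terms_def keys_add_nat)

lemma zero_in_terms: "0 \<in> terms n"
  by (simp add: terms_def)

lemma tdeg_superset: "finite A \<Longrightarrow> Poly_Mapping.keys t \<subseteq> A \<Longrightarrow> tdeg t = (\<Sum>i\<in>A. Poly_Mapping.lookup t i)"
  unfolding tdeg_def by (intro sum.mono_neutral_left) (auto simp: in_keys_iff)

lemma tdeg_add: "tdeg (s + t) = tdeg s + tdeg t"
  using tdeg_superset[of "Poly_Mapping.keys s \<union> Poly_Mapping.keys t" s] tdeg_superset[of "Poly_Mapping.keys s \<union> Poly_Mapping.keys t" t]
    tdeg_superset[of "Poly_Mapping.keys s \<union> Poly_Mapping.keys t" "s + t"]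
  by (simp add: keys_add_nat lookup_add sum.distrib)

lemma tdeg_eq_0_iff: "tdeg t = 0 \<longleftrightarrow> t = 0"
  by (auto simp: tdeg_def in_keys_iff intro!: poly_mapping_eqI)

lemma keys_mult_subset_terms:
  assumes "Poly_Mapping.keys f \<subseteq> terms n" "Poly_Mapping.keys g \<subseteq> terms n"
  shows "Poly_Mapping.keys (f * g) \<subseteq> terms n"
  using keys_mult[of f g] assms terms_add_iff by (fastforce simp: subset_iff)

lemma cring_mpoly_ring: "cring (mpoly_ring n :: (pterm \<Rightarrow>\<^sub>0 'k::field) ring)"
proof (intro cringI abelian_groupI comm_monoidI)
  fix f :: "pterm \<Rightarrow>\<^sub>0 'k" assume "f \<in> carrier (mpoly_ring n)"
  then show "\<exists>g\<in>carrier (mpoly_ring n). g \<oplus>\<^bsub>mpoly_ring n\<^esub> f = \<zero>\<^bsub>mpoly_ring n\<^esub>"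
    by (intro bexI[of _ "- f"]) (auto simp: in_keys_iff)
next
  fix f g :: "pterm \<Rightarrow>\<^sub>0 'k" assume "f \<in> carrier (mpoly_ring n)" "g \<in> carrier (mpoly_ring n)"
  then show "f \<oplus>\<^bsub>mpoly_ring n\<^esub> g \<in> carrier (mpoly_ring n)"
    using keys_add[of f g] by auto
qed (use keys_mult_subset_terms[THEN subsetD] in
      \<open>auto simp: algebra_simps zero_in_terms\<close>)

lemma keys_mon [simp]: "Poly_Mapping.keys (mon t :: pterm \<Rightarrow>\<^sub>0 'k::field) = {t}"
  by (simp add: mon_def)

lemma mon_in_carrier: "t \<in> terms n \<Longrightarrow> mon t \<in> carrier (mpoly_ring n)"
  by (simp add: mon_def)

lemma genideal_mon:
  fixes S :: "pterm set"
  assumes S: "S \<subseteq> terms n"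
  shows "genideal (mpoly_ring n) (mon ` S) =
    {f :: pterm \<Rightarrow>\<^sub>0 'k::field. Poly_Mapping.keys f \<subseteq> terms n \<and> (\<forall>m\<in>Poly_Mapping.keys f. \<exists>s\<in>S. \<exists>u. m = s + u)}"
    (is "?I = ?J")
proof
  interpret cring "mpoly_ring n :: (pterm \<Rightarrow>\<^sub>0 'k) ring" by (rule cring_mpoly_ring)
  have mul: "g * f \<in> ?J" if f: "f \<in> ?J" and g: "Poly_Mapping.keys g \<subseteq> terms n" for f g :: "pterm \<Rightarrow>\<^sub>0 'k"
  proof -
    have "\<exists>s\<in>S. \<exists>u. m = s + u" if "m \<in> Poly_Mapping.keys (g * f)" for m
    proof -
      from that keys_mult[of g f] obtain a b where "m = a + b" "b \<in> Poly_Mapping.keys f" by auto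
      moreover from this f obtain s u where "s \<in> S" "b = s + u" by auto
      ultimately show ?thesis by (metis add.left_commute)
    qed
    then show ?thesis using keys_mult_subset_terms[OF g] f by auto
  qed
  have id: "ideal ?J (mpoly_ring n)"
  proof (rule idealI)
    show "subgroup ?J (add_monoid (mpoly_ring n))"
    proof (rule add.subgroupI)
      fix f assume f: "f \<in> ?J"
      have "\<ominus>\<^bsub>mpoly_ring n\<^esub> f = - f"
        using f by (intro minus_equality) (auto simp: in_keys_iff)
      moreover have "Poly_Mapping.keys (- f) = Poly_Mapping.keys f" by (auto simp: in_keys_iff)
      ultimately show "\<ominus>\<^bsub>mpoly_ring n\<^esub> f \<in> ?J" using f by simp
    next
      fix f g assume "f \<in> ?J" "g \<in> ?J"
      then show "f \<oplus>\<^bsub>mpoly_ring n\<^esub> g \<in> ?J" using keys_add[of f g] by auto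
    qed (auto intro: exI[of _ 0])
  next
    fix f g :: "pterm \<Rightarrow>\<^sub>0 'k" assume "f \<in> ?J" "g \<in> carrier (mpoly_ring n)"
    then show "g \<otimes>\<^bsub>mpoly_ring n\<^esub> f \<in> ?J" "f \<otimes>\<^bsub>mpoly_ring n\<^esub> g \<in> ?J"
      using mul by (simp_all add: mult.commute)
  qed (rule ring_axioms)
  have "mon ` S \<subseteq> ?J" using S by (auto simp: mon_def intro!: bexI exI[of _ 0])
  then show "?I \<subseteq> ?J" using genideal_minimal[OF id] by simp
  have SC: "mon ` S \<subseteq> carrier (mpoly_ring n)" using S mon_in_carrier by blast
  have gi: "ideal ?I (mpoly_ring n)" by (rule genideal_ideal[OF SC])
  interpret I: ideal ?I "mpoly_ring n" by (rule gi)
  show "?J \<subseteq> ?I"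
  proof
    fix f assume f: "f \<in> ?J"
    have mem: "Poly_Mapping.single m (Poly_Mapping.lookup f m) \<in> ?I" if m: "m \<in> Poly_Mapping.keys f" for m
    proof -
      from m f obtain s u where s: "s \<in> S" "m = s + u" by auto
      have "u \<in> terms n" using f m s by (auto simp: terms_add_iff)
      then have "Poly_Mapping.single u (Poly_Mapping.lookup f m) \<in> carrier (mpoly_ring n)" by simp
      moreover have "mon s \<in> ?I" using genideal_self[OF SC] s by auto
      ultimately have "Poly_Mapping.single u (Poly_Mapping.lookup f m) \<otimes>\<^bsub>mpoly_ring n\<^esub> mon s \<in> ?I"
        by (rule I.I_l_closed[rotated])
      then show ?thesis by (simp add: mon_def mult_single s add.commute)
    qed
    have "(\<Sum>m\<in>A. Poly_Mapping.single m (Poly_Mapping.lookup f m)) \<in> ?I" if "A \<subseteq> Poly_Mapping.keys f" for A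
      using finite_subset[OF that finite_keys] that
    proof (induction A rule: finite_induct)
      case empty
      then show ?case using I.zero_closed by simp
    next
      case (insert m A)
      then have "Poly_Mapping.single m (Poly_Mapping.lookup f m) \<oplus>\<^bsub>mpoly_ring n\<^esub>
          (\<Sum>m\<in>A. Poly_Mapping.single m (Poly_Mapping.lookup f m)) \<in> ?I"
        using mem by (intro I.a_closed) auto
      then show ?case using insert by simp
    qed
    moreover have "(\<Sum>m\<in>Poly_Mapping.keys f. Poly_Mapping.single m (Poly_Mapping.lookup f m)) = f"
      by (rule poly_mapping_eqI)
        (auto simp: lookup_sum lookup_single when_def in_keys_iff sum.delta')
    ultimately show "f \<in> ?I" by (metis order_refl)
  qed
qed

lemma mon_in_genideal_iff:
  assumes "S \<subseteq> terms n"
  shows "(mon t :: pterm \<Rightarrow>\<^sub>0 'k::field) \<in> genideal (mpoly_ring n) (mon ` S) \<longleftrightarrow>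
    t \<in> terms n \<and> (\<exists>s\<in>S. \<exists>u. t = s + u)"
  by (simp add: genideal_mon[OF assms])

lemma is_min_monomial_basis_iff:
  fixes J :: "(pterm \<Rightarrow>\<^sub>0 'k::field) set"
  assumes "monomial_ideal n J"
  shows "is_min_monomial_basis n J B \<longleftrightarrow>
    B = {t \<in> terms n. mon t \<in> J \<and> (\<forall>s u. t = s + u \<and> mon s \<in> J \<longrightarrow> s = t)}" (is "_ \<longleftrightarrow> B = ?M")
proof -
  obtain S where S: "S \<subseteq> terms n" "J = genideal (mpoly_ring n) (mon ` S)"
    using assms by (auto simp: monomial_ideal_def)
  have ex: "\<exists>s\<in>?M. \<exists>u. t = s + u" if "mon t \<in> J" for t
    using that
  proof (induction "tdeg t" arbitrary: t rule: less_induct)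
    case less
    then have t: "t \<in> terms n" using S by (simp add: mon_in_genideal_iff)
    show ?case
    proof (cases "t \<in> ?M")
      case True
      then show ?thesis by (intro bexI[of _ t] exI[of _ 0]) auto
    next
      case False
      then obtain s u where su: "t = s + u" "mon s \<in> J" "s \<noteq> t" using less.prems t by auto
      then have "tdeg u \<noteq> 0" by (auto simp: tdeg_eq_0_iff)
      then have "tdeg s < tdeg t" using su by (simp add: tdeg_add)
      from less.hyps[OF this su(2)] show ?thesis using su(1) by (metis (no_types, lifting) add.assoc)
    qed
  qed
  have M: "?M \<subseteq> terms n" by auto
  have genM: "genideal (mpoly_ring n) (mon ` ?M) = J"
  proof
    show "genideal (mpoly_ring n) (mon ` ?M) \<subseteq> J"
    proof
      interpret cring "mpoly_ring n :: (pterm \<Rightarrow>\<^sub>0 'k) ring" by (rule cring_mpoly_ring)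
      have "mon ` S \<subseteq> carrier (mpoly_ring n)" using S mon_in_carrier by blast
      then have "ideal J (mpoly_ring n)" unfolding S by (rule genideal_ideal)
      then have "genideal (mpoly_ring n) (mon ` ?M) \<subseteq> J" by (rule genideal_minimal) auto
      then show "x \<in> J" if "x \<in> genideal (mpoly_ring n) (mon ` ?M)" for x using that by blast
    qed
  next
    show "J \<subseteq> genideal (mpoly_ring n) (mon ` ?M)"
    proof
      fix f assume f: "f \<in> J"
      have "\<exists>s\<in>?M. \<exists>u. m = s + u" if "m \<in> Poly_Mapping.keys f" for m
        using f that S(2) by (intro ex) (auto simp: mon_in_genideal_iff[OF S(1)] genideal_mon[OF S(1)])
      then show "f \<in> genideal (mpoly_ring n) (mon ` ?M)"
        unfolding genideal_mon[OF M] using f S by (auto simp: genideal_mon)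
    qed
  qed
  have sub: "?M \<subseteq> C" if C: "C \<subseteq> terms n" "genideal (mpoly_ring n) (mon ` C) = J" for C
  proof
    fix t assume t: "t \<in> ?M"
    then obtain s u where s: "s \<in> C" "t = s + u"
      using mon_in_genideal_iff[OF C(1), of t] C(2) by blast
    have "s \<in> terms n \<and> (\<exists>s'\<in>C. \<exists>u. s = s' + u)"
      using s C(1) by (auto intro!: bexI[of _ s] exI[of _ 0])
    then have "mon s \<in> J" using mon_in_genideal_iff[OF C(1), of s] C(2) by blast
    then have "s = t" using t s(2) by simp
    then show "t \<in> C" using s(1) by simp
  qed
  define M where "M = ?M"
  note M' = M[folded M_def] and genM' = genM[folded M_def] and sub' = sub[folded M_def]
  have "is_min_monomial_basis n J B \<longleftrightarrow> B = M"
  proof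
    assume "is_min_monomial_basis n J B"
    then have B: "B \<subseteq> terms n" "genideal (mpoly_ring n) (mon ` B) = J"
      and min: "\<And>B'. B' \<subset> B \<Longrightarrow> genideal (mpoly_ring n) (mon ` B') \<noteq> J"
      by (simp_all add: is_min_monomial_basis_def)
    have "\<not> M \<subset> B" using min[of M] genM' by metis
    with sub'[OF B] show "B = M" by (simp add: psubset_eq)
  next
    assume B: "B = M"
    have "genideal (mpoly_ring n) (mon ` B') \<noteq> J" if B': "B' \<subset> M" for B'
    proof
      assume "genideal (mpoly_ring n) (mon ` B') = J"
      then have "M \<subseteq> B'" using B' M' by (intro sub') order
      with B' show False by order
    qed
    then show "is_min_monomial_basis n J B"
      by (simp add: is_min_monomial_basis_def B M' genM')
  qed
  then show ?thesis by (simp only: M_def)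
qed

lemma ex1_min_monomial_basis:
  "monomial_ideal n J \<Longrightarrow> \<exists>!B. is_min_monomial_basis n J B"
  by (simp add: is_min_monomial_basis_iff)

text \<open>The constants form a subfield of \<open>R/J\<close>, as \<open>ring.dim\<close> in \<open>hilbert_fun\<close> requires.\<close>

lemma subfield_constants_Quot:
  fixes J :: "(pterm \<Rightarrow>\<^sub>0 'k::field) set"
  assumes J: "monomial_ideal n J" "J \<noteq> carrier (mpoly_ring n)"
  shows "subfield (range (\<lambda>a. J +>\<^bsub>mpoly_ring n\<^esub> Poly_Mapping.single 0 a)) (mpoly_ring n Quot J)"
proof -
  let ?R = "mpoly_ring n :: (pterm \<Rightarrow>\<^sub>0 'k) ring"
  let ?K = "range (Poly_Mapping.single 0) :: (pterm \<Rightarrow>\<^sub>0 'k) set"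
  interpret cring ?R by (rule cring_mpoly_ring)
  obtain S where S: "S \<subseteq> terms n" "J = genideal ?R (mon ` S)"
    using J by (auto simp: monomial_ideal_def)
  have "mon ` S \<subseteq> carrier ?R" using S mon_in_carrier by blast
  then have id: "ideal J ?R" unfolding S by (rule genideal_ideal)
  interpret J: ideal J ?R by (rule id)
  interpret h: ring_hom_ring ?R "?R Quot J" "(+>\<^bsub>?R\<^esub>) J" by (rule J.rcos_ring_hom_ring)
  have minus: "\<ominus>\<^bsub>?R\<^esub> Poly_Mapping.single 0 a = Poly_Mapping.single 0 (- a)" for a :: 'k
    by (rule minus_equality) (auto simp: zero_in_terms simp flip: single_add)
  have KC: "?K \<subseteq> carrier ?R"
  proof
    fix f :: "pterm \<Rightarrow>\<^sub>0 'k" assume "f \<in> ?K"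
    then obtain a where "f = Poly_Mapping.single 0 a" by blast
    then show "f \<in> carrier ?R" by (simp add: zero_in_terms)
  qed
  have "subring ?K ?R"
  proof (rule subringI[OF KC])
    show "\<one>\<^bsub>?R\<^esub> \<in> ?K" by (rule range_eqI[of _ _ 1]) simp
  next
    fix f g :: "pterm \<Rightarrow>\<^sub>0 'k" assume "f \<in> ?K" "g \<in> ?K"
    then obtain a b where ab: "f = Poly_Mapping.single 0 a" "g = Poly_Mapping.single 0 b" by blast
    show "f \<otimes>\<^bsub>?R\<^esub> g \<in> ?K" by (rule range_eqI[of _ _ "a * b"]) (simp add: ab mult_single)
    show "f \<oplus>\<^bsub>?R\<^esub> g \<in> ?K" by (rule range_eqI[of _ _ "a + b"]) (simp add: ab single_add)
  qed (auto simp: minus)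
  then have "subcring ?K ?R" by (rule subcringI')
  moreover have "Units (?R\<lparr>carrier := ?K\<rparr>) = ?K - {\<zero>\<^bsub>?R\<^esub>}"
  proof (intro equalityI subsetI)
    fix f assume "f \<in> Units (?R\<lparr>carrier := ?K\<rparr>)"
    then show "f \<in> ?K - {\<zero>\<^bsub>?R\<^esub>}" by (auto simp: Units_def)
  next
    fix f assume "f \<in> ?K - {\<zero>\<^bsub>?R\<^esub>}"
    then obtain a where "f = Poly_Mapping.single 0 a" and "f \<noteq> 0" by auto
    moreover from this have "a \<noteq> 0" by auto
    ultimately show "f \<in> Units (?R\<lparr>carrier := ?K\<rparr>)"
      by (auto simp: Units_def mult_single intro!: exI[of _ "inverse a"])
  qed
  ultimately have K: "subfield ?K ?R" by (rule subfieldI)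
  have "\<one>\<^bsub>?R Quot J\<^esub> \<noteq> \<zero>\<^bsub>?R Quot J\<^esub>"
  proof
    assume "\<one>\<^bsub>?R Quot J\<^esub> = \<zero>\<^bsub>?R Quot J\<^esub>"
    then have "\<one>\<^bsub>?R\<^esub> \<in> J"
      using J.rcos_const_imp_mem by (simp add: FactRing_def zero_in_terms)
    then show False using J.one_imp_carrier J(2) by blast
  qed
  from h.img_is_subfield(2)[OF K this] show ?thesis by (simp add: image_image)
qed

end

theory Submission
  imports Defs
begin

text \<open>
  Let \<open>I\<close> be the set of terms in \<open>J\<close>, and let \<open>h s t\<close> be the number of terms of degree \<open>t\<close> in the first
  \<open>n - s\<close> variables that are not in \<open>I\<close>; this is the Hilbert function of \<open>R/J\<close> after the last \<open>s\<close> variables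
  are set to zero.  The proof counts the minimal generators of \<open>J\<close> by their last variable: let
  \<open>g s t\<close> be the number of those of degree \<open>t + 1\<close> with last variable \<open>x\<^bsub>n-s\<^esub>\<close>.

  In an almost revlex ideal a variable of a term of \<open>I\<close> may be exchanged for an earlier one (lemma
  \<open>exchange\<close>).  Therefore the generators with last variable \<open>x\<^sub>k\<close> are exactly the products \<open>m x\<^sub>k \<in> I\<close>
  with \<open>m\<close> a term in \<open>x\<^sub>1, \<dots>, x\<^sub>k\<close> outside \<open>I\<close> (\<open>gens_last_var_eq\<close>), that is, they measure the kernel of
  the multiplication by \<open>x\<^sub>k\<close>.  This gives \<open>h (s+1) (t+1) = h s (t+1) - h s t + g s t\<close>.  Moreover a
  generator with last variable \<open>x\<^sub>k\<close> is smaller than every term of its degree in \<open>x\<^sub>1, \<dots>, x\<^bsub>k-1\<^esub>\<close>, so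
  \<open>g s t \<noteq> 0\<close> forces \<open>h (s+1) (t+1) = 0\<close> (\<open>no_std_terms_below_gen\<close>).  In other words \<open>h (s+1)\<close> is the
  difference of \<open>h s\<close> as long as it is positive, and zero from then on; by induction \<open>h s\<close> is the initial
  positive part of \<open>\<Delta>\<^sup>s H\<close>, which ends at \<open>c\<^sub>s\<close>.  Beyond \<open>c\<^bsub>s+1\<^esub>\<close> the recursion reads
  \<open>g s t = h s t - h s (t+1)\<close>, and the sum of all \<open>g s t\<close> telescopes to \<open>h s (c\<^bsub>s+1\<^esub>)\<close> minus the eventual
  value of \<open>h s\<close>.

  Let \<open>\<delta>\<close> be the least \<open>s\<close> for which \<open>h s\<close> vanishes somewhere, hence from there on.  For
  \<open>s \<ge> \<delta>\<close> the eventual value is zero, for \<open>s = \<delta> - 1\<close> it is the value at \<open>\<rho>\<close>, and for smaller \<open>s\<close> there are no generators.  This is the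
  formula.

  Two facts of algebra remain.  The standard terms of degree \<open>t\<close> form a basis of \<open>(R/J)\<^sub>t\<close>
  (\<open>hilbert_fun_eq_card\<close>), and \<open>\<delta>\<close> is the Krull dimension (\<open>krull_dim_monomial_quotient\<close>).  For the second, every
  term of \<open>I\<close> involves one of the first \<open>n - \<delta>\<close> variables, so the primes \<open>(x\<^sub>1, \<dots>, x\<^bsub>n-\<delta>+i\<^esub>)\<close> contain \<open>J\<close>
  and form a chain of length \<open>\<delta>\<close>.  Conversely the number of standard terms of degree less than \<open>D\<close> is
  \<open>O(D\<^sup>\<delta>)\<close>, so more than \<open>\<delta>\<close> polynomials always satisfy an algebraic relation over \<open>K\<close> modulo \<open>J\<close>
  (\<open>algebraic_relation_exists\<close>); but elements \<open>a\<^sub>i \<in> P\<^bsub>i+1\<^esub> - P\<^sub>i\<close> picked along a chain of primes satisfy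
  no such relation (\<open>no_relation_along_chain\<close>).
\<close>

section \<open>The numerical recursion for successive sections\<close>

text \<open>
  The recursion satisfied by the counts \<open>h s t\<close> of standard terms and \<open>g s t\<close> of generators: \<open>h_step\<close>
  is the dimension count for multiplication by the last variable, \<open>g_gap\<close> is the almost revlex
  condition.  The argument \<open>t\<close> of \<open>g\<close> is one less than the degree of the generators that it counts.
\<close>

locale section_counts =
  fixes n :: nat and h g :: "nat \<Rightarrow> nat \<Rightarrow> nat"
  assumes h_0: "s \<le> n \<Longrightarrow> h s 0 = 1"
    and h_step: "s < n \<Longrightarrow> h (Suc s) (Suc t) + h s t = h s (Suc t) + g s t"
    and g_gap: "s < n \<Longrightarrow> g s t \<noteq> 0 \<Longrightarrow> h (Suc s) (Suc t) = 0"
    and h_vanish: "s \<le> n \<Longrightarrow> h s t = 0 \<Longrightarrow> h s (Suc t) = 0"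
begin

abbreviation H :: "nat \<Rightarrow> int" where "H \<equiv> \<lambda>t. int (h 0 t)"

lemma h_vanish_le:
  assumes "s \<le> n" "t \<le> t'" "h s t = 0"
  shows "h s t' = 0"
  using assms(2) by (induction t' rule: dec_induct) (use assms h_vanish in auto)

text \<open>
  By \<open>g_gap\<close> the row \<open>h (s+1)\<close> agrees with the difference of the row \<open>h s\<close> wherever it is positive.  A
  difference of \<open>\<Delta>\<^sup>s H\<close> that is positive up to \<open>t\<close> makes \<open>\<Delta>\<^sup>s H\<close> itself increasing and positive up to
  \<open>t\<close>, so the positivity of \<open>\<Delta>\<^bsup>s+1\<^esup> H\<close> alone determines the range in which the row is positive.
\<close>

lemma h_positive_part_of_derivative:
  assumes "s \<le> n"
  shows "h s t > 0 \<longleftrightarrow> (\<forall>j\<le>t. deriv_fun s H j > 0)" (is "?A s t \<longleftrightarrow> ?B s t")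
    and "h s t > 0 \<Longrightarrow> int (h s t) = deriv_fun s H t"
proof -
  have main: "(?A s t \<longleftrightarrow> ?B s t) \<and> (?A s t \<longrightarrow> int (h s t) = deriv_fun s H t)"
    using assms
  proof (induction s arbitrary: t)
    case 0
    have "?A 0 j" if "?A 0 t" "j \<le> t" for j
      using h_vanish_le[OF _ that(2), of 0] that(1) by (cases "h 0 j = 0") auto
    then have "?A 0 t \<longleftrightarrow> (\<forall>j\<le>t. ?A 0 j)" by blast
    then show ?case by simp
  next
    case (Suc s)
    from Suc.prems have s: "s < n" "Suc s \<le> n" "s \<le> n" by auto
    note IH = Suc.IH[OF s(3)]
    show ?case
    proof (induction t)
      case 0
      then show ?case using h_0[OF s(2)] by simp
    next
      case (Suc t)
      have split: "?B (Suc s) (Suc t) \<longleftrightarrow> ?B (Suc s) t \<and> deriv_fun (Suc s) H (Suc t) > 0"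
        by (auto simp: le_Suc_eq)
      have le: "h (Suc s) u \<le> h s u" for u
      proof (cases u)
        case 0
        then show ?thesis using h_0 s by simp
      next
        case (Suc v)
        then show ?thesis using h_step[OF s(1), of v] g_gap[OF s(1), of v]
          by (cases "g s v = 0") auto
      qed
      have fwd: "?B (Suc s) (Suc t) \<and> int (h (Suc s) (Suc t)) = deriv_fun (Suc s) H (Suc t)"
        if a: "?A (Suc s) (Suc t)"
      proof -
        have 1: "?A (Suc s) t" using a h_vanish[OF s(2), of t] by auto
        then have B: "?B (Suc s) t" using Suc.IH by simp
        have "h s t > 0" "h s (Suc t) > 0" using 1 a le[of t] le[of "Suc t"] by auto
        then have "int (h s t) = deriv_fun s H t" "int (h s (Suc t)) = deriv_fun s H (Suc t)"
          using IH[of t] IH[of "Suc t"] by auto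
        moreover have "g s t = 0" using a g_gap[OF s(1), of t] by auto
        ultimately have "int (h (Suc s) (Suc t)) = deriv_fun (Suc s) H (Suc t)"
          using h_step[OF s(1), of t] by simp
        moreover from this have "deriv_fun (Suc s) H (Suc t) > 0" using a by linarith
        ultimately show ?thesis using B split by blast
      qed
      have bwd: "?A (Suc s) (Suc t)" if b: "?B (Suc s) (Suc t)"
      proof -
        have "?A (Suc s) t" using b split Suc.IH by simp
        then have p: "h s t > 0" using le[of t] by simp
        then have d: "?B s t" "int (h s t) = deriv_fun s H t" using IH[of t] by auto
        have gt: "deriv_fun s H (Suc t) > deriv_fun s H t" using b split by simp
        then have "?B s (Suc t)" using d p by (auto simp: le_Suc_eq)
        then have "int (h s (Suc t)) = deriv_fun s H (Suc t)" using IH[of "Suc t"] by auto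
        then show ?thesis using gt d h_step[OF s(1), of t] by simp
      qed
      show ?case using fwd bwd by blast
    qed
  qed
  show "h s t > 0 \<longleftrightarrow> (\<forall>j\<le>t. deriv_fun s H j > 0)"
    by (rule main[THEN conjunct1])
  show "int (h s t) = deriv_fun s H t" if "h s t > 0"
    by (rule main[THEN conjunct2, THEN mp, OF that])
qed

text \<open>
  \<open>c_max\<close> is a \<open>Max\<close> and has its meaning only if the row \<open>h s\<close> vanishes somewhere, which makes the
  underlying set finite.
\<close>

lemma c_max_H:
  assumes s: "s \<le> n" and z: "h s t = 0"
  shows "h s (c_max H s) > 0" "h s (Suc (c_max H s)) = 0"
proof -
  have eq: "{c. \<forall>j\<le>c. deriv_fun s H j > 0} = {c. h s c > 0}"
    by (simp only: h_positive_part_of_derivative(1)[OF s])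
  have "c \<le> t" if "h s c > 0" for c
    using h_vanish_le[OF s _ z, of c] that by (cases "t \<le> c") auto
  then have "{c. h s c > 0} \<subseteq> {..t}" by auto
  then have fin: "finite {c. h s c > 0}" by (rule finite_subset) simp
  have "0 \<in> {c. h s c > 0}" using h_0[OF s] by simp
  then have "c_max H s \<in> {c. h s c > 0}"
    unfolding c_max_def eq using fin by (intro Max_in) auto
  then show "h s (c_max H s) > 0" by simp
  show "h s (Suc (c_max H s)) = 0"
  proof (rule ccontr)
    assume "h s (Suc (c_max H s)) \<noteq> 0"
    then have "Suc (c_max H s) \<le> c_max H s"
      unfolding c_max_def eq using fin by (intro Max_ge) (auto simp: c_max_def eq)
    then show False by simp
  qed
qed

lemma h_antitone_after_c_max:
  assumes s: "s < n" and z: "h (Suc s) t = 0" and u: "c_max H (Suc s) \<le> u"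
  shows "h s u = h s (Suc u) + g s u"
proof -
  have "h (Suc s) (Suc u) = 0"
    using h_vanish_le[of "Suc s" "Suc (c_max H (Suc s))" "Suc u"] c_max_H(2)[OF _ z] s u by simp
  then show ?thesis using h_step[OF s, of u] by simp
qed

text \<open>
  Below \<open>c\<^bsub>s+1\<^esub>\<close> there are no generators, because \<open>h (s+1)\<close> is positive there; from \<open>c\<^bsub>s+1\<^esub>\<close> on the
  generators are the successive drops of \<open>h s\<close>, and their sum telescopes.
\<close>

lemma sum_g_telescopes:
  assumes s: "s < n" and z: "h (Suc s) t = 0" and const: "\<And>u. u \<ge> T \<Longrightarrow> h s u = v"
    and T: "c_max H (Suc s) \<le> T"
  shows "\<forall>L\<ge>T. (\<Sum>u<L. int (g s u)) = deriv_fun s H (c_max H (Suc s)) - int v \<and> g s L = 0"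
proof (intro allI impI conjI)
  fix L assume L: "T \<le> L"
  define c where "c = c_max H (Suc s)"
  have step: "int (g s u) = int (h s u) - int (h s (Suc u))" if "c \<le> u" for u
    using h_antitone_after_c_max[OF s z, of u] that by (simp add: c_def)
  have before: "g s u = 0" if "u < c" for u
  proof (rule ccontr)
    assume "g s u \<noteq> 0"
    then have "h (Suc s) (Suc u) = 0" by (rule g_gap[OF s])
    then have "h (Suc s) c = 0" using h_vanish_le[of "Suc s" "Suc u" c] s that by simp
    then show False using c_max_H(1)[OF _ z] s by (simp add: c_def)
  qed
  have cL: "c \<le> L" using T L by (simp add: c_def)
  have "(\<Sum>u<L. int (g s u)) = (\<Sum>u=c..<L. int (g s u))"
    by (intro sum.mono_neutral_right) (auto simp: before)
  also have "\<dots> = (\<Sum>u=c..<L. int (h s u) - int (h s (Suc u)))"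
    by (intro sum.cong) (auto simp: step)
  also have "\<dots> = int (h s c) - int (h s L)"
    using cL by (induction L rule: dec_induct) auto
  also have "h s L = v" using const L by simp
  also have "int (h s c) = deriv_fun s H c"
  proof -
    have "h (Suc s) c > 0" using c_max_H(1)[OF _ z] s by (simp add: c_def)
    have "h s c > 0"
    proof (cases c)
      case 0
      then show ?thesis using h_0 s by simp
    next
      case (Suc b)
      then show ?thesis using h_step[OF s, of b] before[of b] \<open>h (Suc s) c > 0\<close> by simp
    qed
    then show ?thesis using h_positive_part_of_derivative(2)[of s c] s by simp
  qed
  finally show "(\<Sum>u<L. int (g s u)) = deriv_fun s H (c_max H (Suc s)) - int v"
    by (simp add: c_def)
  show "g s L = 0"
    using h_antitone_after_c_max[OF s z, of L] const[of L] const[of "Suc L"] L T by simp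
qed

lemma antitone_nat_eventually_const:
  fixes f :: "nat \<Rightarrow> nat"
  assumes "\<And>u. u \<ge> c \<Longrightarrow> f (Suc u) \<le> f u"
  shows "\<exists>T\<ge>c. \<exists>v. \<forall>u\<ge>T. f u = v"
proof -
  obtain T where T: "T \<ge> c" "\<And>u. u \<ge> c \<Longrightarrow> f T \<le> f u"
    using ex_has_least_nat[of "\<lambda>u. u \<ge> c" c f] by auto
  have "f u \<le> f T" if "u \<ge> T" for u
    using that
  proof (induction u rule: dec_induct)
    case (step u)
    then show ?case using assms[of u] T(1) by simp
  qed simp
  then have "\<forall>u\<ge>T. f u = f T" using T by (metis le_antisym order_trans)
  then show ?thesis using T(1) by blast
qed

text \<open>
  The rows fall into three groups.  For \<open>s + 1 < \<delta>\<close> the next row never vanishes and there are no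
  generators; the row \<open>s = \<delta> - 1\<close> descends to its eventual value, attained at \<open>\<rho>\<close>; the rows \<open>s \<ge> \<delta>\<close>
  descend to zero.
\<close>

lemma sum_g_eq_derivatives:
  assumes d: "\<delta> \<le> n" and pos: "\<And>s t. s < \<delta> \<Longrightarrow> h s t > 0"
    and fin: "\<And>s. \<delta> \<le> s \<Longrightarrow> s \<le> n \<Longrightarrow> \<exists>t. h s t = 0"
  shows "\<exists>L. (\<forall>s<n. \<forall>u\<ge>L. g s u = 0) \<and>
    (\<Sum>s<n. \<Sum>u<L. int (g s u)) =
    (if \<delta> = 0
     then (\<Sum>s = 0..<n. deriv_fun s H (c_max H (s + 1)))
     else (\<Sum>s = \<delta>..<n. deriv_fun s H (c_max H (s + 1)))
          + deriv_fun (\<delta> - 1) H (c_max H \<delta>)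
          - deriv_fun (\<delta> - 1) H (rho_min H \<delta>))"
proof -
  define \<epsilon> where "\<epsilon> = \<delta> - 1"
  have inf_row: "g s u = 0" if "Suc s < \<delta>" for s u
    using g_gap[of s u] pos[of "Suc s" "Suc u"] that d by fastforce
  have fin_row: "\<exists>T. \<forall>L\<ge>T. (\<Sum>u<L. int (g s u)) = deriv_fun s H (c_max H (Suc s)) \<and> g s L = 0"
    if s: "\<delta> \<le> s" "s < n" for s
  proof -
    obtain t0 t1 where t: "h s t0 = 0" "h (Suc s) t1 = 0" using fin[of s] fin[of "Suc s"] s by auto
    define T where "T = max t0 (c_max H (Suc s))"
    have c: "h s u = 0" if "u \<ge> T" for u using h_vanish_le[of s t0 u] t s that by (simp add: T_def)
    have "c_max H (Suc s) \<le> T" by (simp add: T_def)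
    from sum_g_telescopes[OF s(2) t(2) c this] show ?thesis by auto
  qed
  have crit_row: "\<exists>T. \<forall>L\<ge>T. (\<Sum>u<L. int (g \<epsilon> u)) = deriv_fun \<epsilon> H (c_max H \<delta>)
      - deriv_fun \<epsilon> H (rho_min H \<delta>) \<and> g \<epsilon> L = 0" if "\<delta> > 0"
  proof -
    have S: "Suc \<epsilon> = \<delta>" "\<epsilon> < n" using that d by (auto simp: \<epsilon>_def)
    have D: "deriv_fun \<epsilon> H u = int (h \<epsilon> u)" for u
      using h_positive_part_of_derivative(2)[of \<epsilon> u] pos[of \<epsilon> u] S by simp
    obtain t where t: "h (Suc \<epsilon>) t = 0" using fin[of \<delta>] d S by auto
    have "h \<epsilon> (Suc u) \<le> h \<epsilon> u" if "u \<ge> c_max H (Suc \<epsilon>)" for u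
      using h_antitone_after_c_max[OF S(2) t that] by simp
    from antitone_nat_eventually_const[of "c_max H (Suc \<epsilon>)" "h \<epsilon>", OF this]
    obtain T v where T: "T \<ge> c_max H (Suc \<epsilon>)" "\<And>u. u \<ge> T \<Longrightarrow> h \<epsilon> u = v" by auto
    have "\<forall>j\<ge>T. deriv_fun (\<delta> - 1) H j = deriv_fun (\<delta> - 1) H (j + 1)"
      using T(2) D by (simp add: \<epsilon>_def)
    then have rho: "\<forall>j\<ge>rho_min H \<delta>. deriv_fun (\<delta> - 1) H j = deriv_fun (\<delta> - 1) H (j + 1)"
      unfolding rho_min_def by (rule LeastI)
    have "h \<epsilon> j = h \<epsilon> (rho_min H \<delta>)" if "j \<ge> rho_min H \<delta>" for j
      using that
    proof (induction j rule: dec_induct)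
      case (step j)
      then show ?case using rho[rule_format, of j] D[of j] D[of "Suc j"] by (simp add: \<epsilon>_def)
    qed simp
    from this[of "max T (rho_min H \<delta>)"] T(2)[of "max T (rho_min H \<delta>)"]
    have v: "v = h \<epsilon> (rho_min H \<delta>)" by simp
    have "h \<epsilon> u = h \<epsilon> (rho_min H \<delta>)" if "u \<ge> T" for u using T(2)[OF that] v by simp
    from sum_g_telescopes[OF S(2) t this T(1)] show ?thesis
      unfolding S(1) D by blast
  qed
  \<comment> \<open>The contribution of row \<open>s\<close>.  For \<open>\<delta> = 0\<close> the truncated \<open>\<epsilon> = 0\<close> leaves only the third case.\<close>
  define R where "R s = (if s < \<epsilon> then 0 else if s < \<delta> then
      deriv_fun \<epsilon> H (c_max H \<delta>) - deriv_fun \<epsilon> H (rho_min H \<delta>)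
      else deriv_fun s H (c_max H (Suc s)))" for s
  have "\<exists>T. \<forall>L\<ge>T. (\<Sum>u<L. int (g s u)) = R s \<and> g s L = 0" if s: "s < n" for s
  proof -
    consider "Suc s < \<delta>" | "\<delta> > 0" "s = \<epsilon>" | "\<delta> \<le> s"
      unfolding \<epsilon>_def by linarith
    then show ?thesis
    proof cases
      case 1
      then show ?thesis using inf_row by (intro exI[of _ 0]) (auto simp: R_def \<epsilon>_def)
    next
      case 2
      then have "R s = deriv_fun \<epsilon> H (c_max H \<delta>) - deriv_fun \<epsilon> H (rho_min H \<delta>)"
        by (auto simp: R_def \<epsilon>_def)
      then show ?thesis using crit_row 2 by simp
    next
      case 3
      then have "R s = deriv_fun s H (c_max H (Suc s))" by (auto simp: R_def \<epsilon>_def)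
      then show ?thesis using fin_row[OF 3 s] by simp
    qed
  qed
  then obtain T where T: "\<And>s L. s < n \<Longrightarrow> L \<ge> T s \<Longrightarrow> (\<Sum>u<L. int (g s u)) = R s \<and> g s L = 0"
    by metis
  define L where "L = Max (insert 0 (T ` {..<n}))"
  have L: "T s \<le> L" if "s < n" for s unfolding L_def using that by (intro Max_ge) auto
  have "g s u = 0" if "s < n" "u \<ge> L" for s u
    using T[OF that(1), of u] L[OF that(1)] that(2) by simp
  then have zero: "\<forall>s<n. \<forall>u\<ge>L. g s u = 0" by simp
  have "(\<Sum>s<n. \<Sum>u<L. int (g s u)) = (\<Sum>s<n. R s)"
    by (intro sum.cong refl) (simp add: T[THEN conjunct1] L)
  also have "(\<Sum>s<n. R s) = (if \<delta> = 0
     then (\<Sum>s = 0..<n. deriv_fun s H (c_max H (s + 1)))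
     else (\<Sum>s = \<delta>..<n. deriv_fun s H (c_max H (s + 1)))
          + deriv_fun (\<delta> - 1) H (c_max H \<delta>)
          - deriv_fun (\<delta> - 1) H (rho_min H \<delta>))"
  proof (cases "\<delta> = 0")
    case True
    then show ?thesis by (auto simp: R_def \<epsilon>_def lessThan_atLeast0)
  next
    case False
    have "Suc \<epsilon> = \<delta>" "\<epsilon> < n" using False d by (auto simp: \<epsilon>_def)
    then have "(\<Sum>s<n. R s) = (\<Sum>s<\<epsilon>. R s) + R \<epsilon> + (\<Sum>s=\<delta>..<n. R s)"
      using sum.atLeastLessThan_concat[of 0 \<epsilon> n R] sum.atLeast_Suc_lessThan[of \<epsilon> n R]
      by (simp add: lessThan_atLeast0)
    moreover have "(\<Sum>s<\<epsilon>. R s) = 0" by (simp add: R_def)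
    moreover have "R \<epsilon> = deriv_fun \<epsilon> H (c_max H \<delta>) - deriv_fun \<epsilon> H (rho_min H \<delta>)"
      using False by (simp add: R_def \<epsilon>_def)
    moreover have "(\<Sum>s=\<delta>..<n. R s) = (\<Sum>s=\<delta>..<n. deriv_fun s H (c_max H (s + 1)))"
      by (intro sum.cong) (auto simp: R_def \<epsilon>_def)
    ultimately show ?thesis using False by (simp add: \<epsilon>_def)
  qed
  finally show ?thesis by (intro exI[of _ L] conjI zero)
qed

end

section \<open>Almost revlex sets of terms\<close>

definition var :: "nat \<Rightarrow> pterm" where "var i = Poly_Mapping.single i 1"

lemma lookup_var: "Poly_Mapping.lookup (var i) j = (if i = j then 1 else 0)"
  by (auto simp: var_def lookup_single)

lemma tdeg_var [simp]: "tdeg (var i) = 1"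
  by (simp add: tdeg_def var_def)

lemma var_in_terms: "var i \<in> terms k \<longleftrightarrow> 1 \<le> i \<and> i \<le> k"
  by (simp add: terms_def var_def)

lemma term_split_var:
  assumes "Poly_Mapping.lookup m i \<noteq> 0"
  shows "\<exists>m'. m = m' + var i"
proof
  show "m = (m - var i) + var i"
    using assms by (intro poly_mapping_eqI) (auto simp: lookup_add lookup_minus lookup_var)
qed

lemma terms_mono: "m \<in> terms k \<Longrightarrow> k \<le> l \<Longrightarrow> m \<in> terms l"
  by (force simp: terms_def)

lemma terms_lookup_0: "m \<in> terms k \<Longrightarrow> k < i \<Longrightarrow> Poly_Mapping.lookup m i = 0"
  by (auto simp: terms_def in_keys_iff subset_iff)

lemma term_Suc_split:
  assumes "m \<in> terms k" "tdeg m = Suc t"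
  obtains m' i where "m = m' + var i" "m' \<in> terms k" "1 \<le> i" "i \<le> k" "tdeg m' = t"
proof -
  have "m \<noteq> 0" using assms(2) by (auto simp: tdeg_def)
  then obtain i where i: "Poly_Mapping.lookup m i \<noteq> 0" by (metis poly_mapping_eqI lookup_zero)
  then obtain m' where m': "m = m' + var i" using term_split_var by blast
  with assms have "m' \<in> terms k" "var i \<in> terms k" "tdeg m' = t"
    by (auto simp: terms_add_iff tdeg_add)
  with m' show thesis by (intro that[of m' i]) (auto simp: var_in_terms)
qed

lemma terms_pred_iff:
  assumes "m \<in> terms k" "k \<ge> 1"
  shows "m \<in> terms (k - 1) \<longleftrightarrow> Poly_Mapping.lookup m k = 0"
proof
  assume z: "Poly_Mapping.lookup m k = 0"
  have "i \<in> {1..k - 1}" if "i \<in> Poly_Mapping.keys m" for i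
  proof -
    have "i \<noteq> k" using that z by (auto simp: in_keys_iff)
    moreover have "i \<in> {1..k}" using assms(1) that by (auto simp: terms_def)
    ultimately show ?thesis by auto
  qed
  then show "m \<in> terms (k - 1)" by (auto simp: terms_def)
qed (use assms terms_lookup_0 in auto)

lemma lookup_le_tdeg: "Poly_Mapping.lookup m i \<le> tdeg m"
proof (cases "i \<in> Poly_Mapping.keys m")
  case True
  then show ?thesis unfolding tdeg_def by (intro member_le_sum) auto
qed (simp add: in_keys_iff)

text \<open>
  A term is determined by its exponents, so the terms in a box inject into a product of intervals.
\<close>

lemma card_bounded_terms:
  fixes b :: "nat \<Rightarrow> nat"
  assumes "finite A"
  shows "finite {m :: pterm. Poly_Mapping.keys m \<subseteq> A \<and> (\<forall>i\<in>A. Poly_Mapping.lookup m i < b i)}" (is "finite ?S")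
    and "card {m :: pterm. Poly_Mapping.keys m \<subseteq> A \<and> (\<forall>i\<in>A. Poly_Mapping.lookup m i < b i)} \<le> (\<Prod>i\<in>A. b i)"
proof -
  let ?f = "\<lambda>m :: pterm. restrict (Poly_Mapping.lookup m) A"
  have inj: "inj_on ?f ?S"
  proof (rule inj_onI)
    fix m m' assume m: "m \<in> ?S" "m' \<in> ?S" "?f m = ?f m'"
    have "Poly_Mapping.lookup m i = Poly_Mapping.lookup m' i" for i
    proof (cases "i \<in> A")
      case True
      then show ?thesis using m(3) by (metis restrict_apply')
    next
      case False
      then have "i \<notin> Poly_Mapping.keys m" "i \<notin> Poly_Mapping.keys m'" using m by auto
      then show ?thesis by (simp add: in_keys_iff)
    qed
    then show "m = m'" by (rule poly_mapping_eqI)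
  qed
  have sub: "?f ` ?S \<subseteq> (\<Pi>\<^sub>E i\<in>A. {..<b i})" by auto
  have fin: "finite (\<Pi>\<^sub>E i\<in>A. {..<b i})" using assms by (intro finite_PiE) auto
  show "finite ?S" using inj sub fin by (rule inj_on_finite)
  show "card ?S \<le> (\<Prod>i\<in>A. b i)"
    using card_inj_on_le[OF inj sub fin] assms by (simp add: card_PiE)
qed

lemma finite_terms_of_deg: "finite {m \<in> terms k. tdeg m = t}"
proof (rule finite_subset)
  have "Poly_Mapping.lookup m i < Suc t" if "tdeg m = t" for m i
    using lookup_le_tdeg[of m i] that by simp
  then show "{m \<in> terms k. tdeg m = t} \<subseteq>
      {m. Poly_Mapping.keys m \<subseteq> {1..k} \<and> (\<forall>i\<in>{1..k}. Poly_Mapping.lookup m i < Suc t)}"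
    by (auto simp: terms_def)
qed (rule card_bounded_terms, simp)

definition min_gens :: "pterm set \<Rightarrow> pterm set" where
  "min_gens I = {b \<in> I. \<forall>s u. b = s + u \<and> s \<in> I \<longrightarrow> s = b}"

definition std_terms :: "pterm set \<Rightarrow> nat \<Rightarrow> nat \<Rightarrow> pterm set" where
  "std_terms I k t = {m \<in> terms k. tdeg m = t \<and> m \<notin> I}"

definition gens_last_var :: "pterm set \<Rightarrow> nat \<Rightarrow> nat \<Rightarrow> pterm set" where
  "gens_last_var I k t = {b \<in> min_gens I. b \<in> terms k \<and> b \<notin> terms (k - 1) \<and> tdeg b = t}"

lemma finite_std_terms: "finite (std_terms I k t)"
  by (rule finite_subset[OF _ finite_terms_of_deg[of k t]]) (auto simp: std_terms_def)

lemma finite_gens_last_var: "finite (gens_last_var I k t)"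
  by (rule finite_subset[OF _ finite_terms_of_deg[of k t]]) (auto simp: gens_last_var_def)

lemma multiple_of_min_gen: "m \<in> I \<Longrightarrow> \<exists>b\<in>min_gens I. \<exists>u. m = b + u"
proof (induction "tdeg m" arbitrary: m rule: less_induct)
  case less
  show ?case
  proof (cases "m \<in> min_gens I")
    case True
    then show ?thesis by (intro bexI[of _ m] exI[of _ 0]) auto
  next
    case False
    then obtain s u where su: "m = s + u" "s \<in> I" "s \<noteq> m" using less.prems by (auto simp: min_gens_def)
    then have "tdeg u \<noteq> 0" by (auto simp: tdeg_eq_0_iff)
    then have "tdeg s < tdeg m" using su by (simp add: tdeg_add)
    from less.hyps[OF this su(2)] show ?thesis using su(1) by (metis add.assoc)
  qed
qed

text \<open>
  The set of terms of a proper almost revlex ideal, described without reference to the ring.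
\<close>

locale almost_revlex_terms =
  fixes n :: nat and I :: "pterm set"
  assumes I_terms: "I \<subseteq> terms n"
    and zero_notin_I: "0 \<notin> I"
    and I_up: "m \<in> I \<Longrightarrow> u \<in> terms n \<Longrightarrow> m + u \<in> I"
    and revlex: "b \<in> min_gens I \<Longrightarrow> m \<in> terms n \<Longrightarrow> tdeg m = tdeg b \<Longrightarrow> degrevlex_gr m b \<Longrightarrow> m \<in> I"
begin

text \<open>
  Let \<open>b\<close> be a generator dividing \<open>m x\<^sub>j\<close>.  If the cofactor contains \<open>x\<^sub>j\<close>, then \<open>b\<close> divides \<open>m\<close>.
  Otherwise \<open>b\<close> contains \<open>x\<^sub>j\<close>, and \<open>b x\<^sub>i / x\<^sub>j\<close> has the degree of \<open>b\<close> and is larger, hence lies in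
  \<open>I\<close>.
\<close>

lemma exchange:
  assumes mj: "m + var j \<in> I" and ij: "1 \<le> i" "i < j"
  shows "m + var i \<in> I"
proof -
  have T: "m \<in> terms n" "j \<le> n" using mj I_terms by (auto simp: terms_add_iff var_in_terms)
  then have i: "var i \<in> terms n" using ij by (simp add: var_in_terms)
  obtain b u where b: "b \<in> min_gens I" "m + var j = b + u" using multiple_of_min_gen[OF mj] by blast
  have bI: "b \<in> I" using b by (simp add: min_gens_def)
  have bu: "b \<in> terms n" "u \<in> terms n" using b(2) mj I_terms by (metis subsetD terms_add_iff)+
  show ?thesis
  proof (cases "Poly_Mapping.lookup u j = 0")
    case True
    have "Poly_Mapping.lookup (m + var j) j = Poly_Mapping.lookup (b + u) j" using b(2) by simp
    then have "Poly_Mapping.lookup b j \<noteq> 0" using True by (simp add: lookup_add lookup_var)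
    then obtain c where c: "b = c + var j" using term_split_var by blast
    have "degrevlex_gr (c + var i) b"
      unfolding degrevlex_gr_def c using ij
      by (intro disjI2 conjI exI[of _ j]) (auto simp: tdeg_add lookup_add lookup_var)
    moreover have "c + var i \<in> terms n" using c bu i by (simp add: terms_add_iff)
    ultimately have "c + var i \<in> I"
      using revlex[OF b(1)] c by (simp add: tdeg_add)
    then have "(c + var i) + u \<in> I" by (rule I_up) (rule bu)
    moreover have "m = c + u"
    proof -
      have "m + var j = (c + u) + var j" using b(2) c by (simp only: ac_simps)
      then show ?thesis by simp
    qed
    ultimately show ?thesis by (simp add: ac_simps)
  next
    case False
    then obtain v where v: "u = v + var j" using term_split_var by blast
    then have "m + var j = (b + v) + var j" using b(2) by (simp only: ac_simps)
    then have "m = b + v" by simp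
    moreover have "v \<in> terms n" using v bu by (simp add: terms_add_iff)
    ultimately have "m \<in> I" using I_up bI by simp
    then show ?thesis by (rule I_up) (rule i)
  qed
qed

text \<open>
  Exchanging the variables one at a time turns any term in \<open>x\<^sub>k, x\<^bsub>k+1\<^esub>, \<dots>\<close> into any term of the same
  degree in \<open>x\<^sub>1, \<dots>, x\<^sub>k\<close>.  The cofactor \<open>u\<close> carries the variables that have been exchanged already.
\<close>

lemma exchange_all:
  assumes "m + u \<in> I" "Poly_Mapping.keys m \<subseteq> {k..}" "m' \<in> terms k" "tdeg m' = tdeg m"
  shows "m' + u \<in> I"
  using assms
proof (induction "tdeg m" arbitrary: m m' u)
  case 0
  then have "m = 0" "m' = 0" by (metis tdeg_eq_0_iff)+
  then show ?case using 0 by simp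
next
  case (Suc t)
  have m: "m \<in> terms n" using Suc.prems(1) I_terms by (auto simp: terms_add_iff)
  obtain a j where a: "m = a + var j" "tdeg a = t" "1 \<le> j"
    using term_Suc_split[OF m, of t] Suc.hyps(2) by metis
  have m't: "tdeg m' = Suc t" using Suc.prems(4) Suc.hyps(2) by simp
  obtain c i where c: "m' = c + var i" "c \<in> terms k" "1 \<le> i" "i \<le> k" "tdeg c = t"
    using term_Suc_split[OF Suc.prems(3) m't] by metis
  have j: "Poly_Mapping.keys a \<subseteq> {k..}" "k \<le> j"
    using Suc.prems(2) a by (auto simp: keys_add_nat var_def)
  have aj: "(a + u) + var j \<in> I" using Suc.prems(1) a by (simp add: ac_simps)
  have "(a + u) + var i \<in> I"
  proof (cases "i = j")
    case False
    then show ?thesis using exchange[OF aj c(3)] c(4) j(2) by simp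
  qed (use aj in simp)
  then have "a + (var i + u) \<in> I" by (simp add: ac_simps)
  then have "c + (var i + u) \<in> I" using Suc.hyps(1)[of a] a j c by simp
  then show ?case using c by (simp add: ac_simps)
qed

text \<open>
  A product \<open>m x\<^sub>k \<in> I\<close> with \<open>m \<notin> I\<close> is minimal: a proper divisor \<open>m x\<^sub>k / x\<^sub>j\<close> in \<open>I\<close> with \<open>j < k\<close> would still
  contain \<open>x\<^sub>k\<close>, and exchanging that \<open>x\<^sub>k\<close> for \<open>x\<^sub>j\<close> would put \<open>m\<close> into \<open>I\<close>; for \<open>j = k\<close> the divisor
  is \<open>m\<close> itself.
\<close>

lemma gens_last_var_eq:
  assumes k: "1 \<le> k" "k \<le> n"
  shows "gens_last_var I k (Suc t) = (\<lambda>m. m + var k) ` {m \<in> std_terms I k t. m + var k \<in> I}"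
proof (intro equalityI subsetI)
  fix b assume "b \<in> gens_last_var I k (Suc t)"
  then have b: "b \<in> I" "\<And>s u. b = s + u \<Longrightarrow> s \<in> I \<Longrightarrow> s = b" "b \<in> terms k" "b \<notin> terms (k - 1)" "tdeg b = Suc t"
    by (auto simp: gens_last_var_def min_gens_def)
  then have "Poly_Mapping.lookup b k \<noteq> 0" using terms_pred_iff k by blast
  then obtain m where m: "b = m + var k" using term_split_var by blast
  have "m \<noteq> b"
  proof
    assume "m = b"
    then have "tdeg m = tdeg (m + var k)" using m by simp
    then show False by (simp add: tdeg_add)
  qed
  then have "m \<notin> I" using b(2) m by blast
  then show "b \<in> (\<lambda>m. m + var k) ` {m \<in> std_terms I k t. m + var k \<in> I}"
    using b m by (auto simp: std_terms_def terms_add_iff tdeg_add)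
next
  fix b assume "b \<in> (\<lambda>m. m + var k) ` {m \<in> std_terms I k t. m + var k \<in> I}"
  then obtain m where m: "b = m + var k" "m \<in> terms k" "tdeg m = t" "m \<notin> I" "b \<in> I"
    by (auto simp: std_terms_def)
  have bk: "b \<in> terms k" using m k by (simp add: terms_add_iff var_in_terms)
  have "Poly_Mapping.lookup b k \<noteq> 0" using m by (simp add: lookup_add lookup_var)
  then have nb: "b \<notin> terms (k - 1)" using terms_pred_iff[OF bk] k by simp
  have "s = b" if su: "b = s + u" "s \<in> I" for s u
  proof (rule ccontr)
    assume "s \<noteq> b"
    then have "tdeg u \<noteq> 0" using su by (auto simp: tdeg_eq_0_iff)
    then obtain e where e: "tdeg u = Suc e" by (cases "tdeg u") auto
    have u: "u \<in> terms k" using bk su by (simp add: terms_add_iff)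
    obtain v j where v: "u = v + var j" "v \<in> terms k" "1 \<le> j" "j \<le> k"
      using term_Suc_split[OF u e] by metis
    then have vn: "v \<in> terms n" using terms_mono k(2) by blast
    have sv: "s + v \<in> I" using su(2) vn by (rule I_up)
    have eq: "(s + v) + var j = m + var k" using su(1) v(1) m(1) by (simp add: ac_simps)
    show False
    proof (cases "j = k")
      case True
      then have "s + v = m" using eq by simp
      then show False using sv m by simp
    next
      case False
      have "Poly_Mapping.lookup (s + v) k \<noteq> 0"
        using False arg_cong[OF eq, of "\<lambda>p. Poly_Mapping.lookup p k"] by (simp add: lookup_add lookup_var)
      then obtain w where w: "s + v = w + var k" using term_split_var by blast
      have "w + var j \<in> I" using exchange[of w k j] sv w v False by simp
      moreover have "w + var j = m"
      proof -
        have "(w + var j) + var k = m + var k" using eq[unfolded w] by (simp only: ac_simps)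
        then show ?thesis by simp
      qed
      ultimately show False using m by simp
    qed
  qed
  then show "b \<in> gens_last_var I k (Suc t)"
    using m bk nb by (auto simp: gens_last_var_def min_gens_def tdeg_add)
qed

lemma std_terms_split:
  assumes k: "1 \<le> k" "k \<le> n"
  shows "std_terms I k (Suc t) = std_terms I (k - 1) (Suc t) \<union> (\<lambda>m. m + var k) ` {m \<in> std_terms I k t. m + var k \<notin> I}"
    (is "?L = ?A \<union> ?B")
    and "std_terms I (k - 1) (Suc t) \<inter> (\<lambda>m. m + var k) ` {m \<in> std_terms I k t. m + var k \<notin> I} = {}"
proof -
  show "?L = ?A \<union> ?B"
  proof (intro equalityI subsetI)
    fix m assume m: "m \<in> ?L"
    then have mk: "m \<in> terms k" by (simp add: std_terms_def)
    show "m \<in> ?A \<union> ?B"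
    proof (cases "Poly_Mapping.lookup m k = 0")
      case True
      then show ?thesis using m terms_pred_iff[OF mk k(1)] by (simp add: std_terms_def)
    next
      case False
      then obtain a where a: "m = a + var k" using term_split_var by blast
      have "var k \<in> terms n" using k by (simp add: var_in_terms)
      then have "a \<notin> I" using I_up[of a "var k"] m a by (auto simp: std_terms_def)
      then show ?thesis using m a by (auto simp: std_terms_def terms_add_iff tdeg_add)
    qed
  next
    fix m assume "m \<in> ?A \<union> ?B"
    then show "m \<in> ?L"
      using terms_mono[of m "k - 1" k] k by (auto simp: std_terms_def terms_add_iff tdeg_add var_in_terms)
  qed
  have "a + var k \<notin> terms (k - 1)" for a using k by (simp add: terms_add_iff var_in_terms) linarith
  then show "?A \<inter> ?B = {}" by (auto simp: std_terms_def)
qed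

text \<open>
  A term in \<open>x\<^sub>1, \<dots>, x\<^bsub>k-1\<^esub>\<close> exceeds, in the degree reverse lexicographic order, every term of the same
  degree with last variable \<open>x\<^sub>k\<close>: this is where the almost revlex condition is used in full strength.
\<close>

lemma no_std_terms_below_gen:
  assumes k: "1 \<le> k" "k \<le> n" and "gens_last_var I k t \<noteq> {}"
  shows "std_terms I (k - 1) t = {}"
proof -
  obtain b where b: "b \<in> min_gens I" "b \<in> terms k" "b \<notin> terms (k - 1)" "tdeg b = t"
    using assms(3) by (auto simp: gens_last_var_def)
  have bk: "Poly_Mapping.lookup b k \<noteq> 0" using b terms_pred_iff k by blast
  have "m \<in> I" if m: "m \<in> terms (k - 1)" "tdeg m = t" for m
  proof (rule revlex[OF b(1)])
    show "m \<in> terms n" using terms_mono[OF m(1), of n] k by simp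
    have "Poly_Mapping.lookup m j = 0" if "j \<ge> k" for j using terms_lookup_0[OF m(1), of j] that k by simp
    moreover have "Poly_Mapping.lookup b j = 0" if "j > k" for j using terms_lookup_0[OF b(2) that] .
    ultimately show "degrevlex_gr m b"
      unfolding degrevlex_gr_def using bk m b by (intro disjI2 conjI exI[of _ k]) auto
  qed (use m b in simp)
  then show ?thesis by (auto simp: std_terms_def)
qed

text \<open>
  The recursion compares two partitions: the standard terms of degree \<open>t + 1\<close> by whether they contain
  the last variable \<open>x\<^sub>k\<close>, and those of degree \<open>t\<close> by whether their product with \<open>x\<^sub>k\<close> stays standard.
\<close>

sublocale section_counts n "\<lambda>s t. card (std_terms I (n - s) t)" "\<lambda>s t. card (gens_last_var I (n - s) (Suc t))"
proof
  fix s t :: nat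
  show "card (std_terms I (n - s) 0) = 1"
  proof -
    have "std_terms I (n - s) 0 = {0}"
      using zero_notin_I by (auto simp: std_terms_def tdeg_eq_0_iff zero_in_terms)
    then show ?thesis by simp
  qed
  {
    assume "card (std_terms I (n - s) t) = 0"
    then have z: "std_terms I (n - s) t = {}" by (simp add: finite_std_terms)
    have "m \<in> I" if m: "m \<in> terms (n - s)" "tdeg m = Suc t" for m
    proof -
      obtain a i where a: "m = a + var i" "a \<in> terms (n - s)" "1 \<le> i" "i \<le> n - s" "tdeg a = t"
        using term_Suc_split[OF m] by metis
      then have "a \<in> I" using z by (auto simp: std_terms_def)
      then show ?thesis unfolding a by (rule I_up) (use a in \<open>auto simp: var_in_terms\<close>)
    qed
    then show "card (std_terms I (n - s) (Suc t)) = 0" by (auto simp: std_terms_def card_eq_0_iff)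
  }
  assume s: "s < n"
  define k where "k = n - s"
  have k: "1 \<le> k" "k \<le> n" "n - Suc s = k - 1" using s by (auto simp: k_def)
  {
    assume "card (gens_last_var I (n - s) (Suc t)) \<noteq> 0"
    then have "gens_last_var I k (Suc t) \<noteq> {}" by (auto simp: k_def)
    then show "card (std_terms I (n - Suc s) (Suc t)) = 0"
      using no_std_terms_below_gen[OF k(1,2)] k(3) by simp
  }
  let ?in = "{m \<in> std_terms I k t. m + var k \<in> I}"
  let ?out = "{m \<in> std_terms I k t. m + var k \<notin> I}"
  have inj: "inj_on (\<lambda>m. m + var k) M" for M by (simp add: inj_on_def)
  have fin: "finite ?in" "finite ?out" using finite_std_terms by auto
  have "card (std_terms I k (Suc t)) = card (std_terms I (k - 1) (Suc t)) + card ((\<lambda>m. m + var k) ` ?out)"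
    unfolding std_terms_split(1)[OF k(1,2)]
    by (rule card_Un_disjoint) (use finite_std_terms fin std_terms_split(2)[OF k(1,2)] in auto)
  moreover have "card (std_terms I k t) = card ?in + card ?out"
  proof -
    have "std_terms I k t = ?in \<union> ?out" by blast
    moreover have "card (?in \<union> ?out) = card ?in + card ?out" using fin by (intro card_Un_disjoint) auto
    ultimately show ?thesis by simp
  qed
  moreover have "card (gens_last_var I k (Suc t)) = card ?in"
    unfolding gens_last_var_eq[OF k(1,2)] by (rule card_image[OF inj])
  ultimately show "card (std_terms I (n - Suc s) (Suc t)) + card (std_terms I (n - s) t) =
      card (std_terms I (n - s) (Suc t)) + card (gens_last_var I (n - s) (Suc t))"
    unfolding k(3) k_def[symmetric] by (simp add: card_image[OF inj])
qed

lemma card_min_gens: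
  assumes L: "\<forall>s<n. \<forall>t\<ge>L. card (gens_last_var I (n - s) (Suc t)) = 0"
  shows "card (min_gens I) = (\<Sum>s<n. \<Sum>t<L. card (gens_last_var I (n - s) (Suc t)))"
proof -
  let ?G = "\<lambda>s t. gens_last_var I (n - s) (Suc t)"
  have "min_gens I = (\<Union>s\<in>{..<n}. \<Union>t\<in>{..<L}. ?G s t)"
  proof (intro equalityI subsetI)
    fix b assume b: "b \<in> min_gens I"
    then have bI: "b \<in> I" by (simp add: min_gens_def)
    define k where "k = (LEAST k. b \<in> terms k)"
    have bn: "b \<in> terms n" using bI I_terms by blast
    have bk: "b \<in> terms k" unfolding k_def using bn by (rule LeastI)
    have kn: "k \<le> n" unfolding k_def using bn by (rule Least_le)
    have "k \<noteq> 0"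
    proof
      assume "k = 0"
      then have "b = 0" using bk by (auto simp: terms_def)
      then show False using bI zero_notin_I by simp
    qed
    then have nk: "b \<notin> terms (k - 1)" using not_less_Least[of "k - 1" "\<lambda>k. b \<in> terms k"] by (simp add: k_def)
    have "tdeg b \<noteq> 0" using bI zero_notin_I by (auto simp: tdeg_eq_0_iff)
    then obtain t where t: "tdeg b = Suc t" by (cases "tdeg b") auto
    have s: "n - (n - k) = k" "n - k < n" using kn \<open>k \<noteq> 0\<close> by auto
    have G: "b \<in> ?G (n - k) t" unfolding s using b bk nk t by (simp add: gens_last_var_def)
    have "t < L"
    proof (rule ccontr)
      assume "\<not> t < L"
      then have "card (?G (n - k) t) = 0" using L s(2) by simp
      then show False using G finite_gens_last_var by auto
    qed
    then show "b \<in> (\<Union>s\<in>{..<n}. \<Union>t\<in>{..<L}. ?G s t)" using G s(2) by blast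
  qed (auto simp: gens_last_var_def)
  moreover have disj: "s = s'" if b: "m \<in> ?G s t" "m \<in> ?G s' t'" "s < n" "s' < n" for m s s' t t'
  proof (rule ccontr)
    assume "s \<noteq> s'"
    then consider "n - s \<le> n - s' - 1" | "n - s' \<le> n - s - 1" using b(3,4) by linarith
    then show False
    proof cases
      case 1
      then show False using b terms_mono[of m "n - s" "n - s' - 1"] by (simp add: gens_last_var_def)
    next
      case 2
      then show False using b terms_mono[of m "n - s'" "n - s - 1"] by (simp add: gens_last_var_def)
    qed
  qed
  moreover have "card (\<Union>s\<in>{..<n}. \<Union>t\<in>{..<L}. ?G s t) = (\<Sum>s<n. card (\<Union>t\<in>{..<L}. ?G s t))"
  proof (rule card_UN_disjoint)
    show "\<forall>s\<in>{..<n}. \<forall>s'\<in>{..<n}. s \<noteq> s' \<longrightarrow> (\<Union>t\<in>{..<L}. ?G s t) \<inter> (\<Union>t\<in>{..<L}. ?G s' t) = {}"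
      using disj by blast
  qed (simp_all add: finite_gens_last_var)
  moreover have "card (\<Union>t\<in>{..<L}. ?G s t) = (\<Sum>t<L. card (?G s t))" for s
  proof (rule card_UN_disjoint)
    show "\<forall>t\<in>{..<L}. \<forall>t'\<in>{..<L}. t \<noteq> t' \<longrightarrow> ?G s t \<inter> ?G s t' = {}"
      by (auto simp: gens_last_var_def)
  qed (simp_all add: finite_gens_last_var)
  ultimately show ?thesis by (simp only:)
qed

text \<open>
  This number turns out to be the Krull dimension of the quotient.
\<close>

definition gen_dim :: nat where
  "gen_dim = (LEAST s. \<exists>t. std_terms I (n - s) t = {})"

lemma gen_dim_props:
  shows "gen_dim \<le> n" "\<exists>t. std_terms I (n - gen_dim) t = {}"
    "s < gen_dim \<Longrightarrow> std_terms I (n - s) t \<noteq> {}"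
    "gen_dim \<le> s \<Longrightarrow> \<exists>t. std_terms I (n - s) t = {}"
proof -
  have "std_terms I (n - n) 1 = {}" by (auto simp: std_terms_def terms_def tdeg_def)
  then have n: "\<exists>t. std_terms I (n - n) t = {}" by blast
  show "gen_dim \<le> n" unfolding gen_dim_def using n by (rule Least_le)
  show ex: "\<exists>t. std_terms I (n - gen_dim) t = {}" unfolding gen_dim_def using n by (rule LeastI)
  show "std_terms I (n - s) t \<noteq> {}" if "s < gen_dim"
    using not_less_Least[OF that[unfolded gen_dim_def]] by blast
  show "\<exists>t. std_terms I (n - s) t = {}" if "gen_dim \<le> s"
  proof -
    have "std_terms I (n - s) t \<subseteq> std_terms I (n - gen_dim) t" for t
      using terms_mono[of _ "n - s" "n - gen_dim"] that by (auto simp: std_terms_def)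
    then show ?thesis using ex by blast
  qed
qed

text \<open>
  A term of \<open>I\<close> in the last \<open>gen_dim\<close> variables only could be exchanged for every term of its degree in
  the first \<open>n - (gen_dim - 1)\<close> variables, so that the section before the one chosen as \<open>gen_dim\<close> would
  vanish in that degree.
\<close>

lemma keys_meet_first_vars:
  assumes "m \<in> I"
  shows "\<exists>i\<in>{1..n - gen_dim}. i \<in> Poly_Mapping.keys m"
proof (rule ccontr)
  assume no: "\<not> ?thesis"
  have mn: "Poly_Mapping.keys m \<subseteq> {1..n}" using assms I_terms by (auto simp: terms_def)
  then have keys: "Poly_Mapping.keys m \<subseteq> {Suc (n - gen_dim)..}" using no by (fastforce simp: not_le[symmetric])
  show False
  proof (cases "gen_dim = 0")
    case True
    then have "Poly_Mapping.keys m = {}" using mn no by (metis all_not_in_conv diff_zero subsetD)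
    then show False using assms zero_notin_I by simp
  next
    case False
    then have eq: "Suc (n - gen_dim) = n - (gen_dim - 1)" using gen_dim_props(1) by simp
    have "m' \<in> I" if "m' \<in> terms (n - (gen_dim - 1))" "tdeg m' = tdeg m" for m'
      using exchange_all[of m 0 _ m'] assms keys that unfolding eq by simp
    then have "std_terms I (n - (gen_dim - 1)) (tdeg m) = {}" by (auto simp: std_terms_def)
    then show False using gen_dim_props(3)[of "gen_dim - 1"] False by simp
  qed
qed

text \<open>
  If no standard term of degree \<open>t\<close> in the first \<open>n - gen_dim\<close> variables exists, then \<open>I\<close> contains the
  \<open>t\<close>-th powers of these variables.  Their exponents in standard terms are bounded by the constant \<open>t\<close>, and only the
  exponents of the other \<open>gen_dim\<close> variables grow with the degree.
\<close>

lemma card_std_terms_bound: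
  "\<exists>C. \<forall>D. card {m \<in> terms n. m \<notin> I \<and> tdeg m < D} \<le> C * D ^ gen_dim \<and> finite {m \<in> terms n. m \<notin> I \<and> tdeg m < D}"
proof -
  define r where "r = n - gen_dim"
  have rn: "r \<le> n" "n - r = gen_dim" using gen_dim_props(1) by (auto simp: r_def)
  obtain t where t: "std_terms I r t = {}" using gen_dim_props(2) by (auto simp: r_def)
  have small: "Poly_Mapping.lookup m i < t" if m: "m \<in> terms n" "m \<notin> I" and i: "i \<in> {1..r}" for m i
  proof (rule ccontr)
    assume "\<not> Poly_Mapping.lookup m i < t"
    then have le: "t \<le> Poly_Mapping.lookup m i" by simp
    define p where "p = Poly_Mapping.single i t"
    have "p \<in> terms r" "tdeg p = t" using i by (auto simp: p_def terms_def tdeg_def)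
    then have pI: "p \<in> I" using t by (auto simp: std_terms_def)
    have eq: "m = p + (m - p)"
      using le by (intro poly_mapping_eqI) (auto simp: p_def lookup_add lookup_minus lookup_single when_def)
    then have "m - p \<in> terms n" using m(1) by (metis terms_add_iff)
    then have "m \<in> I" using I_up[OF pI] eq by metis
    then show False using m by simp
  qed
  define b where "b D i = (if i \<le> r then t else D)" for D i :: nat
  define S where "S D = {m :: pterm. Poly_Mapping.keys m \<subseteq> {1..n} \<and> (\<forall>i\<in>{1..n}. Poly_Mapping.lookup m i < b D i)}" for D
  have sub: "{m \<in> terms n. m \<notin> I \<and> tdeg m < D} \<subseteq> S D" for D
  proof
    fix m assume m: "m \<in> {m \<in> terms n. m \<notin> I \<and> tdeg m < D}"
    have "Poly_Mapping.lookup m i < b D i" if "i \<in> {1..n}" for i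
      using small[of m i] m that lookup_le_tdeg[of m i] by (auto simp: b_def)
    then show "m \<in> S D" using m by (simp add: S_def terms_def)
  qed
  have S: "finite (S D)" "card (S D) \<le> (\<Prod>i\<in>{1..n}. b D i)" for D
    unfolding S_def by (rule card_bounded_terms; simp)+
  have prod: "(\<Prod>i\<in>{1..n}. b D i) = t ^ r * D ^ gen_dim" for D
  proof -
    have "{1..n} = {1..r} \<union> {r<..n}" using rn by auto
    then have "(\<Prod>i\<in>{1..n}. b D i) = (\<Prod>i\<in>{1..r}. b D i) * (\<Prod>i\<in>{r<..n}. b D i)"
      by (simp only:) (rule prod.union_disjoint, auto)
    also have "(\<Prod>i\<in>{1..r}. b D i) = t ^ r" by (simp add: b_def)
    also have "(\<Prod>i\<in>{r<..n}. b D i) = D ^ gen_dim" by (simp add: b_def rn)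
    finally show ?thesis .
  qed
  have "card {m \<in> terms n. m \<notin> I \<and> tdeg m < D} \<le> t ^ r * D ^ gen_dim" for D
    using card_mono[OF S(1) sub[of D]] S(2)[of D] prod[of D] by simp
  moreover have "finite {m \<in> terms n. m \<notin> I \<and> tdeg m < D}" for D
    using finite_subset[OF sub S(1)] .
  ultimately show ?thesis by (intro exI[of _ "t ^ r"]) simp
qed

end

section \<open>The Hilbert function counts standard terms\<close>

definition restrict_poly :: "pterm set \<Rightarrow> (pterm \<Rightarrow>\<^sub>0 'k::field) \<Rightarrow> (pterm \<Rightarrow>\<^sub>0 'k)" where
  "restrict_poly S f = (\<Sum>m\<in>Poly_Mapping.keys f \<inter> S. Poly_Mapping.single m (Poly_Mapping.lookup f m))"

lemma lookup_restrict_poly: "Poly_Mapping.lookup (restrict_poly S f) m = (if m \<in> S then Poly_Mapping.lookup f m else 0)"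
proof -
  have "Poly_Mapping.lookup (restrict_poly S f) m =
      (\<Sum>m'\<in>Poly_Mapping.keys f \<inter> S. if m' = m then Poly_Mapping.lookup f m' else 0)"
    by (simp add: restrict_poly_def lookup_sum lookup_single when_def)
  also have "\<dots> = (if m \<in> S then Poly_Mapping.lookup f m else 0)"
    by (auto simp: in_keys_iff)
  finally show ?thesis .
qed

lemma keys_restrict_poly: "Poly_Mapping.keys (restrict_poly S f) = Poly_Mapping.keys f \<inter> S"
  by (auto simp: in_keys_iff lookup_restrict_poly split: if_splits)

lemma keys_diff_restrict_poly: "Poly_Mapping.keys (f - restrict_poly S f) = Poly_Mapping.keys f - S"
  by (auto simp: in_keys_iff lookup_restrict_poly lookup_minus split: if_splits)

lemma lookup_const_mult:
  "Poly_Mapping.lookup (Poly_Mapping.single 0 a * f) m = a * Poly_Mapping.lookup (f :: pterm \<Rightarrow>\<^sub>0 'k::field) m"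
  by (simp add: mult_map_scale_conv_mult[symmetric] Poly_Mapping.map.rep_eq when_def)

context
  fixes n :: nat and J :: "(pterm \<Rightarrow>\<^sub>0 'k::field) set" and I :: "pterm set"
  assumes J: "monomial_ideal n J" and I_def: "I = {t. mon t \<in> J}"
begin

lemma ideal_J: "ideal J (mpoly_ring n)"
proof -
  interpret cring "mpoly_ring n :: (pterm \<Rightarrow>\<^sub>0 'k) ring" by (rule cring_mpoly_ring)
  obtain S where S: "S \<subseteq> terms n" "J = genideal (mpoly_ring n) (mon ` S)"
    using J by (auto simp: monomial_ideal_def)
  have "mon ` S \<subseteq> carrier (mpoly_ring n)" using S mon_in_carrier by blast
  then show ?thesis unfolding S by (rule genideal_ideal)
qed

lemma J_eq: "J = {f. Poly_Mapping.keys f \<subseteq> I}"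
  and I_terms: "I \<subseteq> terms n"
  and I_up: "m \<in> I \<Longrightarrow> u \<in> terms n \<Longrightarrow> m + u \<in> I"
proof -
  obtain S where S: "S \<subseteq> terms n" "J = genideal (mpoly_ring n) (mon ` S)"
    using J by (auto simp: monomial_ideal_def)
  have I: "I = {t \<in> terms n. \<exists>s\<in>S. \<exists>u. t = s + u}"
    unfolding I_def S(2) mon_in_genideal_iff[OF S(1)] by simp
  show "J = {f. Poly_Mapping.keys f \<subseteq> I}" unfolding S(2) genideal_mon[OF S(1)] I by auto
  show "I \<subseteq> terms n" using I by blast
  show "m + u \<in> I" if "m \<in> I" "u \<in> terms n"
    using that unfolding I by (auto simp: terms_add_iff) (metis add.assoc)
qed

lemma coset_eq_iff:
  assumes f: "Poly_Mapping.keys f \<subseteq> terms n" and g: "Poly_Mapping.keys g \<subseteq> terms n"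
  shows "J +>\<^bsub>mpoly_ring n\<^esub> f = J +>\<^bsub>mpoly_ring n\<^esub> g \<longleftrightarrow> Poly_Mapping.keys (f - g) \<subseteq> I"
proof -
  let ?R = "mpoly_ring n :: (pterm \<Rightarrow>\<^sub>0 'k) ring"
  interpret cring ?R by (rule cring_mpoly_ring)
  interpret J: ideal J ?R by (rule ideal_J)
  have minus: "\<ominus>\<^bsub>?R\<^esub> h = - h" if "Poly_Mapping.keys h \<subseteq> terms n" for h :: "pterm \<Rightarrow>\<^sub>0 'k"
    using that by (intro minus_equality) (auto simp: in_keys_iff)
  have "f - g \<in> J \<longleftrightarrow> J +>\<^bsub>?R\<^esub> f = J +>\<^bsub>?R\<^esub> g"
    using quotient_eq_iff_same_a_r_cos[OF ideal_J, of f g] f g by (simp add: a_minus_def minus)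
  then show ?thesis by (simp add: J_eq)
qed

text \<open>
  Adding one standard term extends the span by a line: a polynomial with support in the standard
  terms lies in \<open>J\<close> only if it is zero.
\<close>

lemma dimension_std_span:
  assumes "finite A" "A \<subseteq> terms n - I"
  shows "ring.dimension (mpoly_ring n Quot J) (card A)
    (range (\<lambda>a. J +>\<^bsub>mpoly_ring n\<^esub> Poly_Mapping.single 0 a))
    ((\<lambda>f. J +>\<^bsub>mpoly_ring n\<^esub> f) ` {f. Poly_Mapping.keys f \<subseteq> A})"
  using assms
proof (induction A rule: finite_induct)
  case empty
  let ?R = "mpoly_ring n :: (pterm \<Rightarrow>\<^sub>0 'k) ring"
  interpret J: ideal J ?R by (rule ideal_J)
  interpret h: ring_hom_ring ?R "?R Quot J" "(+>\<^bsub>?R\<^esub>) J" by (rule J.rcos_ring_hom_ring)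
  have "(\<lambda>f. J +>\<^bsub>?R\<^esub> f) ` {f. Poly_Mapping.keys f \<subseteq> {}} = {\<zero>\<^bsub>?R Quot J\<^esub>}"
    using h.hom_zero by simp
  then show ?case using h.S.dimension.zero_dim by simp
next
  case (insert m A)
  let ?R = "mpoly_ring n :: (pterm \<Rightarrow>\<^sub>0 'k) ring"
  let ?c = "\<lambda>f. J +>\<^bsub>?R\<^esub> f"
  let ?K = "range (\<lambda>a. ?c (Poly_Mapping.single 0 a))"
  let ?E = "\<lambda>A. ?c ` {f. Poly_Mapping.keys f \<subseteq> A}"
  interpret J: ideal J ?R by (rule ideal_J)
  interpret h: ring_hom_ring ?R "?R Quot J" "(+>\<^bsub>?R\<^esub>) J" by (rule J.rcos_ring_hom_ring)
  have A: "A \<subseteq> terms n" "m \<in> terms n" "m \<notin> I" using insert.prems by auto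
  have mc: "mon m \<in> carrier ?R" by (rule mon_in_carrier[OF A(2)])
  have notin: "?c (mon m) \<notin> ?E A"
  proof
    assume "?c (mon m) \<in> ?E A"
    then obtain g where g: "Poly_Mapping.keys g \<subseteq> A" "?c (mon m) = ?c g" by auto
    then have "Poly_Mapping.keys (mon m - g) \<subseteq> I"
      using coset_eq_iff[of "mon m" g] A by auto
    moreover have "Poly_Mapping.lookup g m = 0" using g(1) insert.hyps by (auto simp: in_keys_iff)
    then have "m \<in> Poly_Mapping.keys (mon m - g)"
      by (simp add: in_keys_iff lookup_minus mon_def)
    ultimately show False using A by blast
  qed
  have comb: "?c (Poly_Mapping.single 0 a) \<otimes>\<^bsub>?R Quot J\<^esub> ?c (mon m) \<oplus>\<^bsub>?R Quot J\<^esub> ?c g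
      = ?c (Poly_Mapping.single m a + g)" if "Poly_Mapping.keys g \<subseteq> A" for a g
  proof -
    have carr: "Poly_Mapping.single 0 a \<in> carrier ?R" "g \<in> carrier ?R" "Poly_Mapping.single m a \<in> carrier ?R"
      using that A by (auto simp: zero_in_terms)
    have "?c (Poly_Mapping.single 0 a) \<otimes>\<^bsub>?R Quot J\<^esub> ?c (mon m) = ?c (Poly_Mapping.single m a)"
      using h.hom_mult[OF carr(1) mc] by (simp add: mon_def mult_single)
    then show ?thesis using h.hom_add[OF carr(3,2)] by simp
  qed
  have "?E (insert m A) = h.S.line_extension ?K (?c (mon m)) (?E A)"
  proof (intro equalityI subsetI)
    fix x assume "x \<in> ?E (insert m A)"
    then obtain f where f: "Poly_Mapping.keys f \<subseteq> insert m A" "x = ?c f" by auto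
    let ?g = "restrict_poly A f"
    have g: "Poly_Mapping.keys ?g \<subseteq> A" by (auto simp: keys_restrict_poly)
    have "f = Poly_Mapping.single m (Poly_Mapping.lookup f m) + ?g"
      using f(1) insert.hyps(2)
      by (intro poly_mapping_eqI) (auto simp: lookup_add lookup_single lookup_restrict_poly when_def in_keys_iff)
    then have "x = ?c (Poly_Mapping.single 0 (Poly_Mapping.lookup f m)) \<otimes>\<^bsub>?R Quot J\<^esub> ?c (mon m) \<oplus>\<^bsub>?R Quot J\<^esub> ?c ?g"
      using comb[OF g] f(2) by metis
    then show "x \<in> h.S.line_extension ?K (?c (mon m)) (?E A)"
      unfolding h.S.line_extension_mem_iff using g by blast
  next
    fix x assume "x \<in> h.S.line_extension ?K (?c (mon m)) (?E A)"
    then obtain a g where g: "Poly_Mapping.keys g \<subseteq> A"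
      "x = ?c (Poly_Mapping.single 0 a) \<otimes>\<^bsub>?R Quot J\<^esub> ?c (mon m) \<oplus>\<^bsub>?R Quot J\<^esub> ?c g"
      unfolding h.S.line_extension_mem_iff by blast
    have "Poly_Mapping.keys (Poly_Mapping.single m a + g) \<subseteq> insert m A"
      using keys_add[of "Poly_Mapping.single m a" g] g(1) by (auto split: if_splits)
    then show "x \<in> ?E (insert m A)" unfolding g(2) comb[OF g(1)] by blast
  qed
  moreover have "h.S.dimension (Suc (card A)) ?K (h.S.line_extension ?K (?c (mon m)) (?E A))"
    by (rule h.S.dimension.Suc_dim[OF h.hom_closed[OF mc] notin insert.IH]) (use insert.prems in blast)
  ultimately show ?case using insert.hyps by simp
qed

lemma hilbert_fun_eq_card:
  assumes "J \<noteq> carrier (mpoly_ring n)"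
  shows "hilbert_fun n J t = card (std_terms I n t)"
proof -
  let ?R = "mpoly_ring n :: (pterm \<Rightarrow>\<^sub>0 'k) ring"
  let ?c = "\<lambda>f. J +>\<^bsub>?R\<^esub> f"
  interpret J: ideal J ?R by (rule ideal_J)
  interpret Q: ring "?R Quot J" by (rule J.quotient_is_ring)
  have "?c ` homogeneous_part n t = ?c ` {f. Poly_Mapping.keys f \<subseteq> std_terms I n t}"
  proof (intro equalityI subsetI)
    fix x assume "x \<in> ?c ` homogeneous_part n t"
    then obtain f where f: "Poly_Mapping.keys f \<subseteq> terms_of_deg n t" "x = ?c f"
      by (auto simp: homogeneous_part_def)
    let ?g = "restrict_poly (std_terms I n t) f"
    have fn: "Poly_Mapping.keys f \<subseteq> terms n" using f(1) by (auto simp: terms_of_deg_def)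
    have "Poly_Mapping.keys (f - ?g) \<subseteq> I"
      using f(1) by (auto simp: keys_diff_restrict_poly std_terms_def terms_of_deg_def)
    then have "?c f = ?c ?g"
      using coset_eq_iff[OF fn, of ?g] fn by (auto simp: keys_restrict_poly)
    then show "x \<in> ?c ` {f. Poly_Mapping.keys f \<subseteq> std_terms I n t}"
      unfolding f(2) by (auto simp: keys_restrict_poly)
  next
    fix x assume "x \<in> ?c ` {f. Poly_Mapping.keys f \<subseteq> std_terms I n t}"
    then obtain f where "Poly_Mapping.keys f \<subseteq> std_terms I n t" "x = ?c f" by blast
    then show "x \<in> ?c ` homogeneous_part n t"
      by (intro image_eqI[of _ _ f]) (auto simp: homogeneous_part_def std_terms_def terms_of_deg_def)
  qed
  moreover have "std_terms I n t \<subseteq> terms n - I" by (auto simp: std_terms_def)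
  note dim = dimension_std_span[OF finite_std_terms this]
  ultimately show ?thesis
    unfolding hilbert_fun_def
    using Q.dimI[OF subfield_constants_Quot[OF J assms] dim] by (simp add: over_def)
qed

end

section \<open>Algebraic relations and chains of primes\<close>

text \<open>
  A homogeneous linear system with more unknowns (indexed by \<open>E\<close>) than equations (indexed by \<open>B\<close>),
  solved by Gaussian elimination.
\<close>

lemma homogeneous_system_nontrivial:
  fixes a :: "'e \<Rightarrow> 'b \<Rightarrow> 'k::field"
  assumes "finite B" "finite E" "card B < card E"
  shows "\<exists>c. (\<exists>e\<in>E. c e \<noteq> 0) \<and> (\<forall>b\<in>B. (\<Sum>e\<in>E. c e * a e b) = 0)"
  using assms
proof (induction B arbitrary: E a rule: finite_induct)
  case empty
  then have "E \<noteq> {}" by auto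
  then show ?case by (intro exI[of _ "\<lambda>_. 1"]) auto
next
  case (insert b B)
  show ?case
  proof (cases "\<forall>e\<in>E. a e b = 0")
    case True
    obtain c where "\<exists>e\<in>E. c e \<noteq> 0" "\<forall>b\<in>B. (\<Sum>e\<in>E. c e * a e b) = 0"
      using insert.IH[of E a] insert.prems insert.hyps by auto
    then show ?thesis using True by (intro exI[of _ c]) auto
  next
    case False
    then obtain e0 where e0: "e0 \<in> E" "a e0 b \<noteq> 0" by blast
    define E' where "E' = E - {e0}"
    define a' where "a' e b' = a e b' - a e b / a e0 b * a e0 b'" for e b'
    have E': "finite E'" "card B < card E'" "E = insert e0 E'" "e0 \<notin> E'"
      using insert.prems insert.hyps e0 by (auto simp: E'_def)
    obtain c where c: "\<exists>e\<in>E'. c e \<noteq> 0" "\<forall>b\<in>B. (\<Sum>e\<in>E'. c e * a' e b) = 0"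
      using insert.IH[OF E'(1,2), of a'] by auto
    define S where "S = (\<Sum>e\<in>E'. c e * a e b)"
    define d where "d e = (if e = e0 then - S / a e0 b else c e)" for e
    have sum_d: "(\<Sum>e\<in>E. d e * a e x) = - S / a e0 b * a e0 x + (\<Sum>e\<in>E'. c e * a e x)" for x
    proof -
      have "(\<Sum>e\<in>E'. d e * a e x) = (\<Sum>e\<in>E'. c e * a e x)"
        by (rule sum.cong) (use E'(4) in \<open>auto simp: d_def\<close>)
      then show ?thesis using E' by (simp add: d_def)
    qed
    have sum_a': "(\<Sum>e\<in>E'. c e * a' e x) = (\<Sum>e\<in>E'. c e * a e x) - S / a e0 b * a e0 x" for x
    proof -
      have "S / a e0 b * a e0 x = (\<Sum>e\<in>E'. c e * (a e b / a e0 b * a e0 x))"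
        unfolding S_def sum_divide_distrib sum_distrib_right by (rule sum.cong) simp_all
      then show ?thesis by (simp add: a'_def right_diff_distrib sum_subtractf)
    qed
    have "(\<Sum>e\<in>E. d e * a e x) = 0" if "x \<in> insert b B" for x
    proof (cases "x = b")
      case True
      then show ?thesis using sum_d[of b] e0 by (simp add: S_def)
    next
      case False
      then have "(\<Sum>e\<in>E'. c e * a' e x) = 0" using that c(2) by auto
      then show ?thesis using sum_d[of x] sum_a'[of x] by simp
    qed
    moreover have "\<exists>e\<in>E. d e \<noteq> 0" using c(1) E' by (auto simp: d_def)
    ultimately show ?thesis by (intro exI[of _ d]) auto
  qed
qed

text \<open>
  A chain of primes in a subring \<open>C\<close> of a ring type.  Working with subsets of a ring type instead of a
  ring record keeps ordinary sums, products and powers available for the relation below.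
\<close>

locale prime_chain =
  fixes C :: "'a::comm_ring_1 set" and P :: "nat \<Rightarrow> 'a set" and k :: nat
  assumes C_1: "1 \<in> C" and C_uminus: "x \<in> C \<Longrightarrow> - x \<in> C"
    and C_add: "x \<in> C \<Longrightarrow> y \<in> C \<Longrightarrow> x + y \<in> C"
    and C_mult: "x \<in> C \<Longrightarrow> y \<in> C \<Longrightarrow> x * y \<in> C"
    and P_C: "i \<le> k \<Longrightarrow> P i \<subseteq> C" and P_0: "i \<le> k \<Longrightarrow> 0 \<in> P i"
    and P_1: "i \<le> k \<Longrightarrow> 1 \<notin> P i"
    and P_add: "i \<le> k \<Longrightarrow> x \<in> P i \<Longrightarrow> y \<in> P i \<Longrightarrow> x + y \<in> P i"
    and P_mult: "i \<le> k \<Longrightarrow> x \<in> P i \<Longrightarrow> y \<in> C \<Longrightarrow> x * y \<in> P i"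
    and P_prime: "i \<le> k \<Longrightarrow> x \<in> C \<Longrightarrow> y \<in> C \<Longrightarrow> x * y \<in> P i \<Longrightarrow> x \<in> P i \<or> y \<in> P i"
    and P_step: "i < k \<Longrightarrow> P i \<subset> P (Suc i)"
begin

lemma C_0: "0 \<in> C"
  using P_0[of 0] P_C[of 0] by auto

lemma C_sum: "(\<And>x. x \<in> A \<Longrightarrow> f x \<in> C) \<Longrightarrow> sum f A \<in> C"
  by (induction A rule: infinite_finite_induct) (auto intro: C_0 C_add)

lemma C_prod: "(\<And>x. x \<in> A \<Longrightarrow> f x \<in> C) \<Longrightarrow> prod f A \<in> C"
  by (induction A rule: infinite_finite_induct) (auto intro: C_1 C_mult)

lemma C_power: "x \<in> C \<Longrightarrow> x ^ e \<in> C"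
  by (induction e) (auto intro: C_1 C_mult)

lemma P_sum: "i \<le> k \<Longrightarrow> (\<And>x. x \<in> A \<Longrightarrow> f x \<in> P i) \<Longrightarrow> sum f A \<in> P i"
  by (induction A rule: infinite_finite_induct) (auto intro: P_0 P_add)

lemma P_diff: "i \<le> k \<Longrightarrow> x + y \<in> P i \<Longrightarrow> y \<in> P i \<Longrightarrow> x \<in> P i"
  using P_add[of i "x + y" "y * (- 1)"] P_mult[of i y "- 1"] C_uminus[OF C_1] by simp

lemma P_power:
  assumes "i \<le> k" "x \<in> C" "x ^ e \<in> P i"
  shows "x \<in> P i"
  using assms(3)
proof (induction e)
  case 0
  then show ?case using P_1[OF assms(1)] by simp
next
  case (Suc e)
  then show ?case using P_prime[OF assms(1,2) C_power[OF assms(2)], of e] by auto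
qed

text \<open>
  Suppose a polynomial expression in \<open>a\<^sub>0, \<dots>, a\<^bsub>k-1\<^esub>\<close> with unit coefficients lies in \<open>P\<^sub>0\<close>.  Divide it by the
  highest possible power of \<open>a\<^sub>0\<close>: since \<open>a\<^sub>0 \<notin> P\<^sub>0\<close>, the quotient lies in \<open>P\<^sub>0 \<subseteq> P\<^sub>1\<close>, and since \<open>a\<^sub>0 \<in> P\<^sub>1\<close>,
  the part of the quotient that is free of \<open>a\<^sub>0\<close> lies in \<open>P\<^sub>1\<close>.  Repeating this with \<open>a\<^sub>1, a\<^sub>2, \<dots>\<close> leaves a
  single unit in \<open>P\<^sub>k\<close>.
\<close>

lemma no_relation_along_chain:
  fixes a :: "nat \<Rightarrow> 'a" and E :: "(nat \<Rightarrow> nat) set" and u :: "(nat \<Rightarrow> nat) \<Rightarrow> 'a"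
  assumes a: "\<And>i. i < k \<Longrightarrow> a i \<in> P (Suc i) - P i"
    and E: "finite E" "E \<noteq> {}" "\<And>e e'. e \<in> E \<Longrightarrow> e' \<in> E \<Longrightarrow> (\<And>i. i < k \<Longrightarrow> e i = e' i) \<Longrightarrow> e = e'"
    and u: "\<And>e. e \<in> E \<Longrightarrow> u e \<in> C" "\<And>e. e \<in> E \<Longrightarrow> \<exists>v\<in>C. u e * v = 1"
  shows "(\<Sum>e\<in>E. u e * (\<Prod>i<k. a i ^ e i)) \<notin> P 0"
proof
  assume rel: "(\<Sum>e\<in>E. u e * (\<Prod>i<k. a i ^ e i)) \<in> P 0"
  have aC: "a i \<in> C" if "i < k" for i using a[OF that] P_C[of "Suc i"] that by auto
  have "\<exists>F\<subseteq>E. F \<noteq> {} \<and> (\<forall>e\<in>F. \<forall>e'\<in>F. \<forall>i<j. e i = e' i) \<and>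
      (\<Sum>e\<in>F. u e * (\<Prod>i=j..<k. a i ^ e i)) \<in> P j" if "j \<le> k" for j
    using that
  proof (induction j)
    case 0
    show ?case using rel E by (intro exI[of _ E]) (simp add: lessThan_atLeast0)
  next
    case (Suc j)
    have j: "j < k" "j \<le> k" "Suc j \<le> k" using Suc.prems by auto
    from Suc.IH[OF j(2)] obtain F where F0: "F \<subseteq> E" "F \<noteq> {}" "\<forall>e\<in>F. \<forall>e'\<in>F. \<forall>i<j. e i = e' i"
      "(\<Sum>e\<in>F. u e * (\<Prod>i=j..<k. a i ^ e i)) \<in> P j" by blast
    note F = F0(1,2) F0(3)[rule_format] F0(4)
    have finF: "finite F" using F(1) E(1) finite_subset by blast
    \<comment> \<open>the power of \<open>a j\<close> to divide by; the exponents in \<open>G\<close> are those of the terms that become free of \<open>a j\<close>\<close>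
    define m where "m = Min ((\<lambda>e. e j) ` F)"
    define G where "G = {e \<in> F. e j = m}"
    have m_le: "m \<le> e j" if "e \<in> F" for e unfolding m_def using finF that by (intro Min_le) auto
    have "m \<in> (\<lambda>e. e j) ` F" unfolding m_def using finF F(2) by (intro Min_in) auto
    then have G: "G \<noteq> {}" "G \<subseteq> F" by (auto simp: G_def)
    define r where "r e = u e * (\<Prod>i=Suc j..<k. a i ^ e i)" for e
    have rC: "r e \<in> C" if "e \<in> F" for e
      unfolding r_def using that F(1) by (intro C_mult u(1) C_prod C_power aC) auto
    have "(\<Sum>e\<in>F. u e * (\<Prod>i=j..<k. a i ^ e i)) = a j ^ m * (\<Sum>e\<in>F. a j ^ (e j - m) * r e)"
      unfolding sum_distrib_left
    proof (rule sum.cong[OF refl])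
      fix e assume e: "e \<in> F"
      have "(\<Prod>i=j..<k. a i ^ e i) = a j ^ e j * (\<Prod>i=Suc j..<k. a i ^ e i)"
        using j(1) by (rule prod.atLeast_Suc_lessThan)
      moreover have "a j ^ e j = a j ^ m * a j ^ (e j - m)"
        using m_le[OF e] by (simp flip: power_add)
      ultimately show "u e * (\<Prod>i=j..<k. a i ^ e i) = a j ^ m * (a j ^ (e j - m) * r e)"
        by (simp add: r_def ac_simps)
    qed
    then have "a j ^ m * (\<Sum>e\<in>F. a j ^ (e j - m) * r e) \<in> P j" using F(4) by simp
    moreover have "(\<Sum>e\<in>F. a j ^ (e j - m) * r e) \<in> C"
      by (intro C_sum C_mult C_power aC rC j)
    moreover have "a j ^ m \<notin> P j" using P_power[OF j(2) aC[OF j(1)]] a[OF j(1)] by blast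
    ultimately have "(\<Sum>e\<in>F. a j ^ (e j - m) * r e) \<in> P j"
      using P_prime[OF j(2)] C_power[OF aC[OF j(1)]] by blast
    then have "(\<Sum>e\<in>F. a j ^ (e j - m) * r e) \<in> P (Suc j)" using P_step[OF j(1)] by blast
    moreover have "(\<Sum>e\<in>F. a j ^ (e j - m) * r e) = (\<Sum>e\<in>G. r e) + (\<Sum>e\<in>F - G. a j ^ (e j - m) * r e)"
    proof -
      have "(\<Sum>e\<in>F. a j ^ (e j - m) * r e) = (\<Sum>e\<in>G. a j ^ (e j - m) * r e) + (\<Sum>e\<in>F - G. a j ^ (e j - m) * r e)"
        using sum.subset_diff[OF G(2) finF] by (simp only: add.commute)
      then show ?thesis by (simp add: G_def)
    qed
    moreover have "(\<Sum>e\<in>F - G. a j ^ (e j - m) * r e) \<in> P (Suc j)"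
    proof (rule P_sum[OF j(3)])
      fix e assume e: "e \<in> F - G"
      then have "m < e j" using m_le[of e] by (auto simp: G_def order.order_iff_strict)
      then have "e j - m = Suc (e j - m - 1)" by simp
      then have "a j ^ (e j - m) = a j * a j ^ (e j - m - 1)" by (metis power_Suc)
      then have eq: "a j ^ (e j - m) * r e = a j * (a j ^ (e j - m - 1) * r e)"
        by (simp add: mult.assoc)
      show "a j ^ (e j - m) * r e \<in> P (Suc j)"
        unfolding eq by (rule P_mult[OF j(3)]) (use a[OF j(1)] e in \<open>auto intro!: C_mult C_power aC rC j\<close>)
    qed
    ultimately have "(\<Sum>e\<in>G. r e) \<in> P (Suc j)" using P_diff[OF j(3)] by simp
    moreover have "\<forall>e\<in>G. \<forall>e'\<in>G. \<forall>i<Suc j. e i = e' i"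
      using F(3) G(2) by (auto simp: G_def less_Suc_eq)
    ultimately show ?case using G F(1) unfolding r_def by (intro exI[of _ G]) auto
  qed
  from this[OF order_refl] obtain F where F: "F \<subseteq> E" "F \<noteq> {}" "\<forall>e\<in>F. \<forall>e'\<in>F. \<forall>i<k. e i = e' i"
    "(\<Sum>e\<in>F. u e * (\<Prod>i=k..<k. a i ^ e i)) \<in> P k" by blast
  then obtain e where e: "e \<in> F" by blast
  have "e' = e" if "e' \<in> F" for e'
    using E(3)[of e' e] F(1,3) e that by blast
  then have "F = {e}" using e by blast
  then have "u e \<in> P k" using F(4) by simp
  moreover obtain v where "v \<in> C" "u e * v = 1" using u(2)[of e] e F(1) by blast
  ultimately have "1 \<in> P k" using P_mult[of k "u e" v] by simp
  then show False using P_1 by simp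
qed

end

lemma tdeg_keys_mult:
  fixes f g :: "pterm \<Rightarrow>\<^sub>0 'k::field"
  assumes "\<And>m. m \<in> Poly_Mapping.keys f \<Longrightarrow> tdeg m \<le> d" "\<And>m. m \<in> Poly_Mapping.keys g \<Longrightarrow> tdeg m \<le> e"
    and "m \<in> Poly_Mapping.keys (f * g)"
  shows "tdeg m \<le> d + e"
proof -
  from assms(3) keys_mult[of f g] obtain a b where "m = a + b" "a \<in> Poly_Mapping.keys f" "b \<in> Poly_Mapping.keys g"
    by auto
  then show ?thesis using assms(1)[of a] assms(2)[of b] by (simp add: tdeg_add)
qed

lemma tdeg_keys_power:
  fixes f :: "pterm \<Rightarrow>\<^sub>0 'k::field"
  assumes "\<And>m. m \<in> Poly_Mapping.keys f \<Longrightarrow> tdeg m \<le> d"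
  shows "m \<in> Poly_Mapping.keys (f ^ e) \<Longrightarrow> tdeg m \<le> e * d"
proof (induction e arbitrary: m)
  case 0
  then show ?case by (simp add: tdeg_def)
next
  case (Suc e)
  have "tdeg m \<le> d + e * d"
    by (rule tdeg_keys_mult[of f d "f ^ e" "e * d"]) (use assms Suc in auto)
  then show ?case by simp
qed

lemma tdeg_keys_prod:
  fixes f :: "nat \<Rightarrow> pterm \<Rightarrow>\<^sub>0 'k::field"
  assumes "\<And>i m. i < k \<Longrightarrow> m \<in> Poly_Mapping.keys (f i) \<Longrightarrow> tdeg m \<le> d"
    and "m \<in> Poly_Mapping.keys (\<Prod>i<k. f i)"
  shows "tdeg m \<le> k * d"
  using assms(2,1)
proof (induction k arbitrary: m)
  case 0
  then show ?case by (simp add: tdeg_def)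
next
  case (Suc k)
  have 1: "tdeg m \<le> k * d" if "m \<in> Poly_Mapping.keys (\<Prod>i<k. f i)" for m
    by (rule Suc.IH[OF that], rule Suc.prems(2)[OF less_SucI])
  have 2: "tdeg m \<le> d" if "m \<in> Poly_Mapping.keys (f k)" for m
    using Suc.prems(2)[of k m] that by simp
  have "tdeg m \<le> k * d + d"
    by (rule tdeg_keys_mult[OF 1 2]) (use Suc.prems(1) in simp_all)
  then show ?case by simp
qed

text \<open>
  There are \<open>M\<^sup>k\<close> monomials in \<open>a\<^sub>0, \<dots>, a\<^bsub>k-1\<^esub>\<close> with exponents less than \<open>M\<close>.  Their degrees are at most a
  constant times \<open>M\<close>, so modulo polynomials with all terms in \<open>I\<close> they lie in a space of dimension \<open>O(M\<^sup>d)\<close>.  As \<open>d < k\<close>, they are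
  linearly dependent for large \<open>M\<close>.
\<close>

lemma algebraic_relation_exists:
  fixes a :: "nat \<Rightarrow> pterm \<Rightarrow>\<^sub>0 'k::field"
  assumes fin: "\<And>D. finite {m \<in> terms n. m \<notin> I \<and> tdeg m < D}"
    and card: "\<And>D. card {m \<in> terms n. m \<notin> I \<and> tdeg m < D} \<le> c * D ^ d" and k: "d < k"
    and a: "\<And>i. i < k \<Longrightarrow> Poly_Mapping.keys (a i) \<subseteq> terms n"
  shows "\<exists>E u. finite E \<and> E \<noteq> {} \<and> E \<subseteq> extensional {..<k} \<and> (\<forall>e\<in>E. u e \<noteq> 0) \<and>
    Poly_Mapping.keys (\<Sum>e\<in>E. Poly_Mapping.single 0 (u e) * (\<Prod>i<k. a i ^ e i)) \<subseteq> I"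
proof -
  have "finite (\<Union>i<k. tdeg ` Poly_Mapping.keys (a i))" by simp
  then obtain D where "\<forall>x\<in>(\<Union>i<k. tdeg ` Poly_Mapping.keys (a i)). x \<le> D"
    using finite_nat_set_iff_bounded_le by blast
  then have D: "tdeg m \<le> D" if "i < k" "m \<in> Poly_Mapping.keys (a i)" for i m
    using that by blast
  \<comment> \<open>With \<open>D\<close> bounding the degrees of the \<open>a i\<close>, the dimension is at most \<open>c (k D M + 1)\<^sup>d \<le> c (k D + 1)\<^sup>d M\<^sup>d\<close>,
    which is less than \<open>M\<^bsup>d+1\<^esup>\<close> for this choice of \<open>M\<close>.\<close>
  define M where "M = Suc (c * (k * D + 1) ^ d)"
  define E0 where "E0 = (\<Pi>\<^sub>E i\<in>{..<k}. {..<M})"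
  define B where "B = {m \<in> terms n. m \<notin> I \<and> tdeg m < k * (M * D) + 1}"
  define p where "p e = (\<Prod>i<k. a i ^ e i)" for e :: "nat \<Rightarrow> nat"
  have E0: "finite E0" "card E0 = M ^ k" by (simp_all add: E0_def finite_PiE card_PiE)
  have "card B \<le> c * (k * (M * D) + 1) ^ d" unfolding B_def by (rule card)
  also have "\<dots> \<le> c * (M * (k * D + 1)) ^ d"
    by (intro mult_left_mono power_mono) (auto simp: M_def algebra_simps)
  also have "\<dots> = (c * (k * D + 1) ^ d) * M ^ d" by (simp only: power_mult_distrib ac_simps)
  also have "\<dots> < M * M ^ d" by (intro mult_strict_right_mono) (auto simp: M_def)
  also have "\<dots> = M ^ Suc d" by simp
  also have "\<dots> \<le> M ^ k" using k by (intro power_increasing) (auto simp: M_def)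
  finally have less: "card B < card E0" by (simp add: E0)
  have "finite B" unfolding B_def by (rule fin)
  from homogeneous_system_nontrivial[OF this E0(1) less, of "\<lambda>e m. Poly_Mapping.lookup (p e) m"]
  obtain u :: "(nat \<Rightarrow> nat) \<Rightarrow> 'k" where u: "\<exists>e\<in>E0. u e \<noteq> 0"
    "\<And>b. b \<in> B \<Longrightarrow> (\<Sum>e\<in>E0. u e * Poly_Mapping.lookup (p e) b) = 0" by auto
  define E where "E = {e \<in> E0. u e \<noteq> 0}"
  define F where "F = (\<Sum>e\<in>E. Poly_Mapping.single 0 (u e) * p e)"
  have lookF: "Poly_Mapping.lookup F m = (\<Sum>e\<in>E0. u e * Poly_Mapping.lookup (p e) m)" for m
  proof -
    have "Poly_Mapping.lookup F m = (\<Sum>e\<in>E. u e * Poly_Mapping.lookup (p e) m)"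
      by (simp add: F_def lookup_sum lookup_const_mult)
    also have "\<dots> = (\<Sum>e\<in>E0. u e * Poly_Mapping.lookup (p e) m)"
      by (rule sum.mono_neutral_left) (auto simp: E_def E0)
    finally show ?thesis .
  qed
  have keys_p: "m \<in> terms n \<and> tdeg m < k * (M * D) + 1" if e: "e \<in> E0" and m: "m \<in> Poly_Mapping.keys (p e)" for e m
  proof -
    have tp: "tdeg m' \<le> M * D" if "i < k" "m' \<in> Poly_Mapping.keys (a i ^ e i)" for i m'
    proof -
      have "tdeg m' \<le> e i * D" using tdeg_keys_power[OF D[OF that(1)] that(2)] by simp
      moreover have "e i \<le> M" using PiE_mem[OF e[unfolded E0_def], of i] that(1) by simp
      ultimately show ?thesis by (meson mult_le_mono1 order_trans)
    qed
    have deg: "tdeg m \<le> k * (M * D)"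
      by (rule tdeg_keys_prod[OF tp m[unfolded p_def]])
    have tm: "Poly_Mapping.keys (a i ^ j) \<subseteq> terms n" if "i < k" for i j
    proof (induction j)
      case (Suc j)
      then show ?case using keys_mult_subset_terms[OF a[OF that]] by simp
    qed (simp add: zero_in_terms)
    have kp: "Poly_Mapping.keys (\<Prod>i<l. a i ^ e i) \<subseteq> terms n" if "l \<le> k" for l
      using that
    proof (induction l)
      case (Suc l)
      then show ?case using keys_mult_subset_terms[OF _ tm[of l "e l"], of "\<Prod>i<l. a i ^ e i"] by simp
    qed (simp add: zero_in_terms)
    show ?thesis using deg m kp[OF order_refl] by (auto simp: p_def)
  qed
  have "m \<in> I" if "m \<in> Poly_Mapping.keys F" for m
  proof (rule ccontr)
    assume "m \<notin> I"
    have nz: "(\<Sum>e\<in>E0. u e * Poly_Mapping.lookup (p e) m) \<noteq> 0" using that lookF[of m] by (simp add: in_keys_iff)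
    then obtain e where "e \<in> E0" "u e * Poly_Mapping.lookup (p e) m \<noteq> 0" by (meson sum.neutral)
    then have "m \<in> B" using keys_p[of e m] \<open>m \<notin> I\<close> by (auto simp: in_keys_iff B_def)
    then show False using u(2) nz by blast
  qed
  then have "Poly_Mapping.keys F \<subseteq> I" by blast
  moreover have "finite E" unfolding E_def using E0(1) by simp
  moreover have "E \<noteq> {}" using u(1) by (auto simp: E_def)
  moreover have "E \<subseteq> extensional {..<k}" by (auto simp: E_def E0_def PiE_def)
  ultimately show ?thesis
    unfolding F_def p_def by (intro exI[of _ E] exI[of _ u]) (simp add: E_def)
qed

section \<open>The Krull dimension\<close>

definition vars_ideal :: "nat \<Rightarrow> nat set \<Rightarrow> (pterm \<Rightarrow>\<^sub>0 'k::field) set" where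
  "vars_ideal n A = {f. Poly_Mapping.keys f \<subseteq> terms n \<and> (\<forall>m\<in>Poly_Mapping.keys f. Poly_Mapping.keys m \<inter> A \<noteq> {})}"

lemma ideal_vars_ideal:
  assumes "A \<subseteq> {1..n}"
  shows "ideal (vars_ideal n A) (mpoly_ring n :: (pterm \<Rightarrow>\<^sub>0 'k::field) ring)"
proof -
  interpret cring "mpoly_ring n :: (pterm \<Rightarrow>\<^sub>0 'k) ring" by (rule cring_mpoly_ring)
  have S: "var ` A \<subseteq> terms n" using assms by (auto simp: var_in_terms)
  have "(\<exists>s\<in>var ` A. \<exists>u. m = s + u) \<longleftrightarrow> Poly_Mapping.keys m \<inter> A \<noteq> {}" for m
  proof
    assume "\<exists>s\<in>var ` A. \<exists>u. m = s + u"
    then obtain i u where "i \<in> A" "m = var i + u" by blast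
    then have "i \<in> Poly_Mapping.keys m" by (simp add: in_keys_iff lookup_add lookup_var)
    then show "Poly_Mapping.keys m \<inter> A \<noteq> {}" using \<open>i \<in> A\<close> by blast
  next
    assume "Poly_Mapping.keys m \<inter> A \<noteq> {}"
    then obtain i where "i \<in> A" "Poly_Mapping.lookup m i \<noteq> 0" by (auto simp: in_keys_iff)
    then show "\<exists>s\<in>var ` A. \<exists>u. m = s + u" using term_split_var[of m i] by (auto simp: add.commute)
  qed
  then have eq: "(vars_ideal n A :: (pterm \<Rightarrow>\<^sub>0 'k) set) = genideal (mpoly_ring n) (mon ` var ` A)"
    unfolding genideal_mon[OF S] vars_ideal_def by simp
  have "(mon ` var ` A :: (pterm \<Rightarrow>\<^sub>0 'k) set) \<subseteq> carrier (mpoly_ring n)" using S mon_in_carrier by blast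
  then show ?thesis unfolding eq by (rule genideal_ideal)
qed

text \<open>
  Modulo the ideal, each factor may be replaced by its part that avoids the variables in \<open>A\<close>.  The product of
  these parts avoids \<open>A\<close> as well, so it vanishes if it lies in the ideal, and polynomials have no zero
  divisors.
\<close>

lemma primeideal_vars_ideal:
  assumes A: "A \<subseteq> {1..n}"
  shows "primeideal (vars_ideal n A) (mpoly_ring n :: (pterm \<Rightarrow>\<^sub>0 'k::field) ring)"
proof (rule primeidealI)
  let ?P = "vars_ideal n A :: (pterm \<Rightarrow>\<^sub>0 'k) set"
  show id: "ideal ?P (mpoly_ring n)" by (rule ideal_vars_ideal[OF A])
  then interpret P: ideal ?P "mpoly_ring n" .
  show "cring (mpoly_ring n :: (pterm \<Rightarrow>\<^sub>0 'k) ring)" by (rule cring_mpoly_ring)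
  have "(1 :: pterm \<Rightarrow>\<^sub>0 'k) \<notin> ?P" by (simp add: vars_ideal_def)
  moreover have "(1 :: pterm \<Rightarrow>\<^sub>0 'k) \<in> carrier (mpoly_ring n)" by (simp add: zero_in_terms)
  ultimately show "carrier (mpoly_ring n) \<noteq> ?P" by blast
  fix f g :: "pterm \<Rightarrow>\<^sub>0 'k"
  assume f: "f \<in> carrier (mpoly_ring n)" and g: "g \<in> carrier (mpoly_ring n)"
    and fg: "f \<otimes>\<^bsub>mpoly_ring n\<^esub> g \<in> ?P"
  define S where "S = {m :: pterm. Poly_Mapping.keys m \<inter> A = {}}"
  let ?f = "restrict_poly S f" and ?g = "restrict_poly S g"
  have P: "h - restrict_poly S h \<in> ?P" if "h \<in> carrier (mpoly_ring n)" for h :: "pterm \<Rightarrow>\<^sub>0 'k"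
    using that by (auto simp: vars_ideal_def keys_diff_restrict_poly S_def)
  have C: "restrict_poly S h \<in> carrier (mpoly_ring n)" if "h \<in> carrier (mpoly_ring n)" for h :: "pterm \<Rightarrow>\<^sub>0 'k"
    using that by (auto simp: keys_restrict_poly)
  have avoid: "m \<notin> Poly_Mapping.keys h" if "h \<in> ?P" "m \<in> S" for h m
    using that by (auto simp: vars_ideal_def S_def)
  have eq: "f * g = ?f * ?g + (g * (f - ?f) + ?f * (g - ?g))" by (simp add: algebra_simps)
  have rest: "g * (f - ?f) + ?f * (g - ?g) \<in> ?P"
    using additive_subgroup.a_closed[OF P.additive_subgroup_axioms P.I_l_closed[OF P[OF f] g] P.I_l_closed[OF P[OF g] C[OF f]]] by simp
  have "m \<in> {}" if m: "m \<in> Poly_Mapping.keys (?f * ?g)" for m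
  proof -
    from m keys_mult[of ?f ?g] obtain a b where ab: "m = a + b" "a \<in> Poly_Mapping.keys ?f" "b \<in> Poly_Mapping.keys ?g"
      by auto
    then have "m \<in> S" by (auto simp: keys_restrict_poly S_def keys_add_nat)
    then have "m \<notin> Poly_Mapping.keys (g * (f - ?f) + ?f * (g - ?g))" and "m \<notin> Poly_Mapping.keys (f * g)"
      using avoid[OF rest] avoid[OF fg] by simp_all
    then have "Poly_Mapping.lookup (?f * ?g) m = 0"
      using arg_cong[OF eq, of "\<lambda>h. Poly_Mapping.lookup h m"] by (simp add: in_keys_iff lookup_add)
    then show ?thesis using m by (simp add: in_keys_iff)
  qed
  then have "?f * ?g = 0" by (metis keys_eq_empty all_not_in_conv empty_iff)
  then have "?f = 0 \<or> ?g = 0" by simp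
  then show "f \<in> ?P \<or> g \<in> ?P" using P[OF f] P[OF g] by auto
qed

lemma (in cring) primeideal_image_in_quotient:
  assumes J: "ideal J R" and P: "primeideal P R" and JP: "J \<subseteq> P"
  shows "primeideal ((+>) J ` P) (R Quot J)"
    and "f \<in> carrier R \<Longrightarrow> J +> f \<in> (+>) J ` P \<longleftrightarrow> f \<in> P"
proof -
  interpret J: ideal J R by (rule J)
  interpret P: primeideal P R by (rule P)
  interpret h: ring_hom_ring R "R Quot J" "(+>) J" by (rule J.rcos_ring_hom_ring)
  show mem: "J +> f \<in> (+>) J ` P \<longleftrightarrow> f \<in> P" if f: "f \<in> carrier R" for f
  proof
    assume "J +> f \<in> (+>) J ` P"
    then obtain p where p: "p \<in> P" "J +> f = J +> p" by blast
    then have "f \<ominus> p \<in> P" using quotient_eq_iff_same_a_r_cos[OF J f] JP P.Icarr by blast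
    then have "(f \<ominus> p) \<oplus> p \<in> P" using p(1) by (rule P.a_closed)
    moreover have "(f \<ominus> p) \<oplus> p = f" using f P.Icarr[OF p(1)] by algebra
    ultimately show "f \<in> P" by simp
  qed (rule imageI)
  have car: "carrier (R Quot J) = (+>) J ` carrier R" by (simp only: FactRing_def A_RCOSETS_def' partial_object.simps UNION_singleton_eq_range)
  show "primeideal ((+>) J ` P) (R Quot J)"
  proof (rule primeidealI)
    show "ideal ((+>) J ` P) (R Quot J)" using J P.is_ideal by (rule ring_ideal_imp_quot_ideal)
    show "cring (R Quot J)" by (rule J.quotient_is_cring) (rule is_cring)
    have "J +> \<one> \<notin> (+>) J ` P" using mem[of \<one>] P.one_imp_carrier P.I_notcarr by auto
    then show "carrier (R Quot J) \<noteq> (+>) J ` P" unfolding car by blast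
    fix x y assume "x \<in> carrier (R Quot J)" "y \<in> carrier (R Quot J)" and xy: "x \<otimes>\<^bsub>R Quot J\<^esub> y \<in> (+>) J ` P"
    then obtain f g where fg: "f \<in> carrier R" "g \<in> carrier R" "x = J +> f" "y = J +> g" unfolding car by blast
    then have "J +> (f \<otimes> g) \<in> (+>) J ` P" using xy h.hom_mult[of f g] by simp
    then have "f \<otimes> g \<in> P" using mem[of "f \<otimes> g"] fg by simp
    then show "x \<in> (+>) J ` P \<or> y \<in> (+>) J ` P" using P.I_prime[of f g] fg by blast
  qed
qed

text \<open>
  The two hypotheses on \<open>I\<close> bound the dimension from either side: \<open>meet\<close> provides a chain of primes of
  length \<open>d\<close>, and the growth bound \<open>box\<close> excludes longer chains.
\<close>

lemma krull_dim_monomial_quotient: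
  fixes J :: "(pterm \<Rightarrow>\<^sub>0 'k::field) set"
  assumes J: "monomial_ideal n J" and I: "I = {t. mon t \<in> J}" and d: "d \<le> n"
    and meet: "\<And>m. m \<in> I \<Longrightarrow> Poly_Mapping.keys m \<inter> {1..n - d} \<noteq> {}"
    and box: "\<And>D. finite {m \<in> terms n. m \<notin> I \<and> tdeg m < D}" "\<And>D. card {m \<in> terms n. m \<notin> I \<and> tdeg m < D} \<le> c * D ^ d"
  shows "krull_dim (mpoly_ring n Quot J) = enat d"
proof -
  let ?R = "mpoly_ring n :: (pterm \<Rightarrow>\<^sub>0 'k) ring"
  interpret cring ?R by (rule cring_mpoly_ring)
  note idJ = ideal_J[OF J I]
  interpret J: ideal J ?R by (rule idJ)
  interpret h: ring_hom_ring ?R "?R Quot J" "(+>\<^bsub>?R\<^esub>) J" by (rule J.rcos_ring_hom_ring)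
  note J_keys = J_eq[OF J I] and I_terms = I_terms[OF J I]
  \<comment> \<open>A longer chain is pulled back to the polynomial ring, where an algebraic relation modulo \<open>J \<subseteq> P 0\<close> contradicts it.\<close>
  have upper: "k \<le> d" if PP: "\<forall>i\<le>k. primeideal (PP i) (?R Quot J)" "\<forall>i<k. PP i \<subset> PP (Suc i)"
    for k and PP :: "nat \<Rightarrow> (pterm \<Rightarrow>\<^sub>0 'k) set set"
  proof (rule ccontr)
    assume "\<not> k \<le> d"
    then have k: "d < k" by simp
    define P where "P i = {f \<in> carrier ?R. J +>\<^bsub>?R\<^esub> f \<in> PP i}" for i
    have prime: "primeideal (P i) ?R" if "i \<le> k" for i
      unfolding P_def by (rule h.primeideal_vimage) (use that PP(1) is_cring in auto)
    have car: "carrier (?R Quot J) = (+>\<^bsub>?R\<^esub>) J ` carrier ?R" by (simp only: FactRing_def A_RCOSETS_def' partial_object.simps UNION_singleton_eq_range)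
    have strict: "P i \<subset> P (Suc i)" if "i < k" for i
    proof -
      have sub: "PP i \<subset> PP (Suc i)" using PP(2) that by blast
      then obtain x where x: "x \<in> PP (Suc i)" "x \<notin> PP i" by blast
      have "primeideal (PP (Suc i)) (?R Quot J)" using PP(1) that by simp
      then have "x \<in> carrier (?R Quot J)"
        using x(1) by (meson ideal.Icarr primeideal_def)
      then obtain f where "f \<in> carrier ?R" "x = J +>\<^bsub>?R\<^esub> f" unfolding car by blast
      then have "f \<in> P (Suc i)" "f \<notin> P i" using x by (auto simp: P_def)
      then show ?thesis using sub by (auto simp: P_def)
    qed
    interpret chain: prime_chain "carrier ?R" P k
    proof
      fix i assume i: "i \<le> k"
      interpret Pi: primeideal "P i" ?R by (rule prime[OF i])
      show "P i \<subseteq> carrier ?R" by (auto simp: P_def)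
      show "0 \<in> P i" using Pi.zero_closed by simp
      show "1 \<notin> P i" using Pi.one_imp_carrier Pi.I_notcarr by auto
      show "x + y \<in> P i" if "x \<in> P i" "y \<in> P i" for x y using Pi.a_closed[OF that] by simp
      show "x * y \<in> P i" if "x \<in> P i" "y \<in> carrier ?R" for x y using Pi.I_r_closed[OF that] by simp
      show "x \<in> P i \<or> y \<in> P i" if "x \<in> carrier ?R" "y \<in> carrier ?R" "x * y \<in> P i" for x y
        using Pi.I_prime[OF that(1,2)] that(3) by simp
    next
      fix x y assume "x \<in> carrier ?R" "y \<in> carrier ?R"
      then show "x + y \<in> carrier ?R" "x * y \<in> carrier ?R" using add.m_closed[of x y] m_closed[of x y] by simp_all
    next
      fix x assume "x \<in> carrier ?R"
      then show "- x \<in> carrier ?R" by (auto simp: in_keys_iff)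
    qed (use strict in \<open>auto simp: zero_in_terms\<close>)
    have "\<forall>i<k. \<exists>f. f \<in> P (Suc i) - P i" using strict by blast
    then obtain a where a: "\<And>i. i < k \<Longrightarrow> a i \<in> P (Suc i) - P i" by metis
    have aC: "Poly_Mapping.keys (a i) \<subseteq> terms n" if "i < k" for i using a[OF that] by (auto simp: P_def)
    have "\<exists>E u. finite E \<and> E \<noteq> {} \<and> E \<subseteq> extensional {..<k} \<and> (\<forall>e\<in>E. u e \<noteq> 0) \<and>
        Poly_Mapping.keys (\<Sum>e\<in>E. Poly_Mapping.single 0 (u e) * (\<Prod>i<k. a i ^ e i)) \<subseteq> I"
      by (rule algebraic_relation_exists[OF box k aC])
    then obtain E u where E: "finite E" "E \<noteq> {}" "E \<subseteq> extensional {..<k}" "\<forall>e\<in>E. u e \<noteq> 0"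
      "Poly_Mapping.keys (\<Sum>e\<in>E. Poly_Mapping.single 0 (u e) * (\<Prod>i<k. a i ^ e i)) \<subseteq> I"
      by (elim exE conjE)
    have "(\<Sum>e\<in>E. Poly_Mapping.single 0 (u e) * (\<Prod>i<k. a i ^ e i)) \<in> J" unfolding J_keys using E(5) by simp
    moreover have "J \<subseteq> P 0"
    proof
      fix f assume f: "f \<in> J"
      interpret P0: primeideal "PP 0" "?R Quot J" using PP(1) by simp
      have "J +>\<^bsub>?R\<^esub> f = \<zero>\<^bsub>?R Quot J\<^esub>" using J.a_rcos_const[OF f] by (simp add: FactRing_def)
      then show "f \<in> P 0" using f J.Icarr P0.zero_closed by (simp add: P_def)
    qed
    moreover have "(\<Sum>e\<in>E. Poly_Mapping.single 0 (u e) * (\<Prod>i<k. a i ^ e i)) \<notin> P 0"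
    proof (rule chain.no_relation_along_chain[OF a E(1,2)])
      show "e = e'" if "e \<in> E" "e' \<in> E" "\<And>i. i < k \<Longrightarrow> e i = e' i" for e e'
        by (rule extensionalityI[of _ "{..<k}"]) (use that E(3) in auto)
      show "Poly_Mapping.single 0 (u e) \<in> carrier ?R" for e by (simp add: zero_in_terms)
      show "\<exists>v\<in>carrier ?R. Poly_Mapping.single 0 (u e) * v = 1" if "e \<in> E" for e
        by (rule bexI[of _ "Poly_Mapping.single 0 (inverse (u e))"])
          (use E(4) that in \<open>auto simp: mult_single zero_in_terms\<close>)
    qed
    ultimately show False by blast
  qed
  \<comment> \<open>the images of the ideals generated by the first \<open>n - d + i\<close> variables\<close>
  have lower: "\<exists>P :: nat \<Rightarrow> (pterm \<Rightarrow>\<^sub>0 'k) set set.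
      (\<forall>i\<le>d. primeideal (P i) (?R Quot J)) \<and> (\<forall>i<d. P i \<subset> P (Suc i))"
  proof -
    define Q where "Q i = (vars_ideal n {1..n - d + i} :: (pterm \<Rightarrow>\<^sub>0 'k) set)" for i
    have Q: "primeideal (Q i) ?R" if "i \<le> d" for i
      unfolding Q_def by (rule primeideal_vars_ideal) (use that d in auto)
    have sub: "Q i \<subseteq> Q j" if "i \<le> j" for i j
      using that by (fastforce simp: Q_def vars_ideal_def)
    have "J \<subseteq> Q 0" using meet I_terms by (auto simp: J_keys Q_def vars_ideal_def)
    then have JQ: "J \<subseteq> Q i" for i using sub[of 0 i] by blast
    have "(+>\<^bsub>?R\<^esub>) J ` Q i \<subset> (+>\<^bsub>?R\<^esub>) J ` Q (Suc i)" if "i < d" for i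
    proof -
      let ?x = "mon (var (Suc (n - d + i))) :: pterm \<Rightarrow>\<^sub>0 'k"
      have x: "?x \<in> carrier ?R" by (rule mon_in_carrier) (use that d in \<open>auto simp: var_in_terms\<close>)
      have "?x \<in> Q (Suc i)" "?x \<notin> Q i" using x by (auto simp: Q_def vars_ideal_def var_def)
      then have "J +>\<^bsub>?R\<^esub> ?x \<in> (+>\<^bsub>?R\<^esub>) J ` Q (Suc i)" "J +>\<^bsub>?R\<^esub> ?x \<notin> (+>\<^bsub>?R\<^esub>) J ` Q i"
        using primeideal_image_in_quotient(2)[OF idJ Q JQ x, of i] that by auto
      then show ?thesis using sub[of i "Suc i"] by auto
    qed
    then show ?thesis
      using primeideal_image_in_quotient(1)[OF idJ Q JQ] by (intro exI[of _ "\<lambda>i. (+>\<^bsub>?R\<^esub>) J ` Q i"]) auto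
  qed
  show ?thesis
    unfolding krull_dim_def
  proof (rule antisym)
    show "Sup {enat k |k. \<exists>P. (\<forall>i\<le>k. primeideal (P i) (?R Quot J)) \<and> (\<forall>i<k. P i \<subset> P (Suc i))} \<le> enat d"
      by (rule Sup_least) (use upper in auto)
    show "enat d \<le> Sup {enat k |k. \<exists>P. (\<forall>i\<le>k. primeideal (P i) (?R Quot J)) \<and> (\<forall>i<k. P i \<subset> P (Suc i))}"
      by (rule Sup_upper) (use lower in blast)
  qed
qed

section \<open>The number of minimal generators\<close>

theorem theorem3p10:
  fixes n :: nat
    and J :: "(pterm \<Rightarrow>\<^sub>0 'k::field) set"
    and H :: "nat \<Rightarrow> int"
    and \<delta> :: nat
  assumes proper: "J \<noteq> carrier (mpoly_ring n)"
    and almost_revlex: "almost_revlex n J"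
    and delta: "\<delta> = the_enat (krull_dim (mpoly_ring n Quot J))"
    and hilbert: "H = (\<lambda>t. int (hilbert_fun n J t))"
  shows "int (card (min_monomial_basis n J)) =
    (if \<delta> = 0
     then (\<Sum>s = 0..<n. deriv_fun s H (c_max H (s + 1)))
     else (\<Sum>s = \<delta>..<n. deriv_fun s H (c_max H (s + 1)))
          + deriv_fun (\<delta> - 1) H (c_max H \<delta>)
          - deriv_fun (\<delta> - 1) H (rho_min H \<delta>))"
proof -
  have J: "monomial_ideal n J" using almost_revlex by (simp add: almost_revlex_def)
  define I where "I = {t. (mon t :: pterm \<Rightarrow>\<^sub>0 'k) \<in> J}"
  note I_terms = I_terms[OF J I_def]
  have basis: "min_monomial_basis n J = min_gens I"
  proof -
    have "min_gens I = {t \<in> terms n. mon t \<in> J \<and> (\<forall>s u. t = s + u \<and> mon s \<in> J \<longrightarrow> s = t)}"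
      using I_terms by (auto simp: min_gens_def I_def)
    then show ?thesis
      unfolding min_monomial_basis_def is_min_monomial_basis_iff[OF J] by simp
  qed
  have zero: "0 \<notin> I"
  proof
    assume "0 \<in> I"
    then have "u \<in> I" if "u \<in> terms n" for u using I_up[OF J I_def, of 0 u] that by simp
    then have "I = terms n" using I_terms by blast
    then show False using proper J_eq[OF J I_def] by simp
  qed
  interpret almost_revlex_terms n I
  proof
    show "m \<in> I" if "b \<in> min_gens I" "m \<in> terms n" "tdeg m = tdeg b" "degrevlex_gr m b" for b m
      using almost_revlex that basis by (auto simp: almost_revlex_def terms_of_deg_def I_def)
  qed (use I_terms zero I_up[OF J I_def] in auto)
  have H: "H = (\<lambda>t. int (card (std_terms I (n - 0) t)))"
    using hilbert_fun_eq_card[OF J I_def proper] by (simp add: hilbert)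
  obtain C where C: "\<And>D. card {m \<in> terms n. m \<notin> I \<and> tdeg m < D} \<le> C * D ^ gen_dim"
      "\<And>D. finite {m \<in> terms n. m \<notin> I \<and> tdeg m < D}"
    using card_std_terms_bound by blast
  have "krull_dim (mpoly_ring n Quot J) = enat gen_dim"
  proof (rule krull_dim_monomial_quotient[OF J I_def gen_dim_props(1) _ C(2,1)])
    show "Poly_Mapping.keys m \<inter> {1..n - gen_dim} \<noteq> {}" if "m \<in> I" for m
      using keys_meet_first_vars[OF that] by blast
  qed
  then have \<delta>: "\<delta> = gen_dim" by (simp add: delta)
  have pos: "card (std_terms I (n - s) t) > 0" if "s < \<delta>" for s t
    using gen_dim_props(3)[of s t] that finite_std_terms by (simp add: \<delta> card_gt_0_iff)
  have fin: "\<exists>t. card (std_terms I (n - s) t) = 0" if "\<delta> \<le> s" for s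
    using gen_dim_props(4)[of s] that finite_std_terms by (simp add: \<delta>)
  have "\<delta> \<le> n" using gen_dim_props(1) by (simp add: \<delta>)
  from sum_g_eq_derivatives[OF this pos fin] obtain L where L:
    "\<forall>s<n. \<forall>u\<ge>L. card (gens_last_var I (n - s) (Suc u)) = 0"
    "(\<Sum>s<n. \<Sum>u<L. int (card (gens_last_var I (n - s) (Suc u)))) =
      (if \<delta> = 0
       then (\<Sum>s = 0..<n. deriv_fun s H (c_max H (s + 1)))
       else (\<Sum>s = \<delta>..<n. deriv_fun s H (c_max H (s + 1)))
            + deriv_fun (\<delta> - 1) H (c_max H \<delta>)
            - deriv_fun (\<delta> - 1) H (rho_min H \<delta>))"
    unfolding H by auto
  have "int (card (min_monomial_basis n J)) = (\<Sum>s<n. \<Sum>u<L. int (card (gens_last_var I (n - s) (Suc u))))"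
    unfolding basis card_min_gens[OF L(1)] by simp
  then show ?thesis using L(2) by (simp only:)
qed

end
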